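(* Let $k$ be a field, $R=k[x_1,\ldots,x_d]$ a polynomial ring, $I\subseteq R$ a square-free monomial ideal, and $\mu(I)$ its minimal number of generators. Then $I^n=I^{(n)}$ for every positive integer $n\leq \left\lceil\frac{\mu(I)}{2}\right\rceil$ if and only if $I^n=I^{(n)}$ for every $n\in\mathbb Z_{>0}$.
   Context: For $n\in\mathbb Z_{>0}$, the $n$-th symbolic power of $I$ is $I^{(n)}=\bigcap_{\mathfrak p\in \operatorname{Min}(R/I)} (I^nR_{\mathfrak p}\cap R)$, where $\operatorname{Min}(R/I)$ is the set of minimal primes of $I$. *)

theory Defs
  imports
    Complex_Main
    "HOL-Algebra.Ideal_Product"
    "HOL-Algebra.Algebraic_Closure_Type"
    "HOL-Library.Poly_Mapping"
    "HOL-Computational_Algebra.Fraction_Field"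
begin

text \<open>
  A polynomial is a finitely supported map from exponent vectors to coefficients.
  The polynomial ring in \<open>d\<close> variables is the subring of the type of polynomials in
  the countably many variables \<open>0, 1, 2, \<dots>\<close> that only involves the variables below \<open>d\<close>.
\<close>

type_synonym 'k mpoly = "(nat \<Rightarrow>\<^sub>0 nat) \<Rightarrow>\<^sub>0 'k"

definition mpoly_ring :: "nat \<Rightarrow> ('k::field) mpoly ring" where
  "mpoly_ring d = ring_of_type_algebra\<lparr>carrier := {f. \<forall>a\<in>Poly_Mapping.keys f. Poly_Mapping.keys a \<subseteq> {..<d}}\<rparr>"

definition squarefree_monomials :: "nat \<Rightarrow> ('k::field) mpoly set" where
  "squarefree_monomials d =
     {Poly_Mapping.single a 1 | a. Poly_Mapping.keys a \<subseteq> {..<d} \<and> (\<forall>i. Poly_Mapping.lookup a i \<le> 1)}"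

definition squarefree_monomial_ideal :: "nat \<Rightarrow> ('k::field) mpoly set \<Rightarrow> bool" where
  "squarefree_monomial_ideal d I \<longleftrightarrow> (\<exists>S \<subseteq> squarefree_monomials d. I = Idl\<^bsub>mpoly_ring d\<^esub> S)"

text \<open>The generators are arbitrary ring elements, not just monomials.\<close>

definition min_num_gens :: "('a, 'b) ring_scheme \<Rightarrow> 'a set \<Rightarrow> nat" where
  "min_num_gens R I = (LEAST m. \<exists>G. finite G \<and> card G = m \<and> G \<subseteq> carrier R \<and> Idl\<^bsub>R\<^esub> G = I)"

definition minimal_primes :: "('a, 'b) ring_scheme \<Rightarrow> 'a set \<Rightarrow> 'a set set" where
  "minimal_primes R I =
     {P. primeideal P R \<and> I \<subseteq> P \<and> (\<forall>Q. primeideal Q R \<and> I \<subseteq> Q \<and> Q \<subseteq> P \<longrightarrow> Q = P)}"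

text \<open>
  The next two definitions are meant for a ring \<open>R\<close> whose operations are the restrictions
  of the operations of an integral domain type \<open>'a\<close>, such as \<^term>\<open>mpoly_ring d\<close>. The
  localization at a prime ideal is then realized as a subring of the field of fractions
  of \<open>'a\<close>, with \<open>r \<mapsto> r / 1\<close> as the canonical map.
\<close>

definition localization :: "('a::idom) ring \<Rightarrow> 'a set \<Rightarrow> 'a fract ring" where
  "localization R P =
     ring_of_type_algebra\<lparr>carrier :=
       {Fraction_Field.Fract r s | r s. r \<in> carrier R \<and> s \<in> carrier R - P}\<rparr>"

definition symbolic_power :: "('a::idom) ring \<Rightarrow> 'a set \<Rightarrow> nat \<Rightarrow> 'a set" where
  "symbolic_power R I n =
     {r \<in> carrier R. \<forall>P \<in> minimal_primes R I.
        Fraction_Field.Fract r 1 \<in>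
          Idl\<^bsub>localization R P\<^esub> ((\<lambda>f. Fraction_Field.Fract f 1) ` (I [^]\<^bsub>ideals_set R\<^esub> n))}"

text \<open>Well-formedness: these records are indeed commutative rings without zero divisors.\<close>

lemma domain_ring_of_type_subset:
  fixes C :: "'a::idom set"
  assumes "0 \<in> C" "1 \<in> C" "\<And>x y. x \<in> C \<Longrightarrow> y \<in> C \<Longrightarrow> x + y \<in> C"
    "\<And>x y. x \<in> C \<Longrightarrow> y \<in> C \<Longrightarrow> x * y \<in> C" "\<And>x. x \<in> C \<Longrightarrow> - x \<in> C"
  shows "domain (ring_of_type_algebra\<lparr>carrier := C\<rparr>)"
proof (rule domainI)
  show "cring (ring_of_type_algebra\<lparr>carrier := C\<rparr>)"
  proof (rule cringI)
    show "abelian_group (ring_of_type_algebra\<lparr>carrier := C\<rparr>)"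
    proof (rule abelian_groupI)
      fix x assume "x \<in> carrier (ring_of_type_algebra\<lparr>carrier := C\<rparr>)"
      then show "\<exists>y\<in>carrier (ring_of_type_algebra\<lparr>carrier := C\<rparr>).
          y \<oplus>\<^bsub>ring_of_type_algebra\<lparr>carrier := C\<rparr>\<^esub> x = \<zero>\<^bsub>ring_of_type_algebra\<lparr>carrier := C\<rparr>\<^esub>"
        using assms by (auto simp: ring_of_type_algebra_def intro!: bexI[of _ "- x"])
    qed (use assms in \<open>auto simp: ring_of_type_algebra_def algebra_simps\<close>)
    show "comm_monoid (ring_of_type_algebra\<lparr>carrier := C\<rparr>)"
      by (rule comm_monoidI) (use assms in \<open>auto simp: ring_of_type_algebra_def algebra_simps\<close>)
  qed (auto simp: ring_of_type_algebra_def algebra_simps)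
qed (auto simp: ring_of_type_algebra_def)

lemma domain_mpoly_ring: "domain (mpoly_ring d :: ('k::field) mpoly ring)"
  unfolding mpoly_ring_def
proof (rule domain_ring_of_type_subset, goal_cases)
  case (3 f g)
  then show ?case using Poly_Mapping.keys_add[of f g] by blast
next
  case (4 f g)
  show ?case
  proof safe
    fix a i assume "a \<in> Poly_Mapping.keys (f * g)" and i: "i \<in> Poly_Mapping.keys a"
    then obtain b c where "b \<in> Poly_Mapping.keys f" "c \<in> Poly_Mapping.keys g" "a = b + c"
      using keys_mult[of f g] by blast
    then show "i < d" using 4 i Poly_Mapping.keys_add[of b c] by blast
  qed
qed auto

lemma domain_localization:
  fixes P :: "('k::field) mpoly set"
  assumes "primeideal P (mpoly_ring d)"
  shows "domain (localization (mpoly_ring d) P)"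
proof -
  let ?R = "mpoly_ring d :: 'k mpoly ring"
  interpret R: domain ?R by (rule domain_mpoly_ring)
  interpret P: primeideal P ?R by fact
  have ops [simp]: "x \<otimes>\<^bsub>?R\<^esub> y = x * y" "x \<oplus>\<^bsub>?R\<^esub> y = x + y" "\<one>\<^bsub>?R\<^esub> = 1" "\<zero>\<^bsub>?R\<^esub> = 0" for x y
    by (simp_all add: mpoly_ring_def ring_of_type_algebra_def)
  have z: "0 \<in> P" using P.zero_closed by simp
  have o: "1 \<in> carrier ?R - P"
    using R.one_closed P.one_imp_carrier P.I_notcarr by auto
  have m: "s * t \<in> carrier ?R" if "s \<in> carrier ?R" "t \<in> carrier ?R" for s t
    using R.m_closed[OF that] by simp
  have a: "s + t \<in> carrier ?R" if "s \<in> carrier ?R" "t \<in> carrier ?R" for s t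
    using R.a_closed[OF that] by simp
  have p: "s * t \<in> carrier ?R - P" if "s \<in> carrier ?R - P" "t \<in> carrier ?R - P" for s t
    using m[of s t] P.I_prime[of s t] that by auto
  have u: "- s \<in> carrier ?R" if "s \<in> carrier ?R" for s
    using that by (simp add: mpoly_ring_def)
  show ?thesis
    unfolding localization_def
  proof (rule domain_ring_of_type_subset, goal_cases)
    case 1
    have "(0 :: 'k mpoly fract) = Fraction_Field.Fract 0 1" by (simp add: Zero_fract_def)
    then show ?case using o R.zero_closed by auto
  next
    case 2
    have "(1 :: 'k mpoly fract) = Fraction_Field.Fract 1 1" by (simp add: One_fract_def)
    then show ?case using o by blast
  next
    case (3 x y)
    then obtain r s r' s' where *: "x = Fraction_Field.Fract r s" "y = Fraction_Field.Fract r' s'"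
      "r \<in> carrier ?R" "s \<in> carrier ?R - P" "r' \<in> carrier ?R" "s' \<in> carrier ?R - P" by blast
    then have "s \<noteq> 0" "s' \<noteq> 0" using z by blast+
    then have "x + y = Fraction_Field.Fract (r * s' + r' * s) (s * s')" using *(1,2) by simp
    moreover have "r * s' + r' * s \<in> carrier ?R" using * a m by simp
    ultimately show ?case using p[OF *(4,6)] by blast
  next
    case (4 x y)
    then obtain r s r' s' where *: "x = Fraction_Field.Fract r s" "y = Fraction_Field.Fract r' s'"
      "r \<in> carrier ?R" "s \<in> carrier ?R - P" "r' \<in> carrier ?R" "s' \<in> carrier ?R - P" by blast
    then have "x * y = Fraction_Field.Fract (r * r') (s * s')" by simp
    then show ?case using p[OF *(4,6)] m[OF *(3,5)] by blast
  next
    case (5 x)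
    then obtain r s where *: "x = Fraction_Field.Fract r s" "r \<in> carrier ?R" "s \<in> carrier ?R - P" by blast
    then have "- x = Fraction_Field.Fract (- r) s" by simp
    then show ?case using *(3) u[OF *(2)] by blast
  qed
qed

end

theory Submission
  imports Defs
begin

text \<open>
  Write \<open>\<nu>(a)\<close> for the largest \<open>n\<close> with \<open>x\<^sup>a \<in> I\<^sup>n\<close> and \<open>\<tau>(a)\<close> for the least weight \<open>\<Sum>i\<in>C. a\<^sub>i\<close>
  of a vertex cover \<open>C\<close> of the supports of the minimal monomial generators; then \<open>x\<^sup>a \<in> I\<^bsup>(n)\<^esup>\<close>
  iff \<open>n \<le> \<tau>(a)\<close>, and \<open>\<nu> \<le> \<tau>\<close>. If \<open>x\<^bsup>2a\<^esup> \<in> I\<^bsup>2m+1\<^esup>\<close> with \<open>2m + 1\<close> larger than the number of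
  generators, then by the pigeonhole principle some generator occurs twice and its square can be
  cancelled. Once \<open>2m + 1\<close> is at most the number of generators, \<open>\<tau>(2a) \<ge> 2m + 1\<close> gives
  \<open>\<tau>(a) \<ge> m + 1\<close>, and the hypothesis for the exponent \<open>m + 1\<close> applies. So \<open>\<nu>(2a) = 2\<nu>(a)\<close> for all \<open>a\<close>.
  A superadditive function with this property has one-sided directional derivatives with
  values in the natural numbers that are again of the same kind. Differentiating
  successively in the directions \<open>a, e\<^sub>0, \<dots>, e\<^bsub>d-1\<^esub>\<close> yields a linear \<open>f \<ge> \<nu>\<close> with natural coefficients
  and \<open>f(a) = \<nu>(a)\<close>. The support of \<open>f\<close> is a cover of weight at most \<open>\<nu>(a)\<close>, whence \<open>\<tau> = \<nu>\<close>.
\<close>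

section \<open>Superadditive functions\<close>

text \<open>Homogeneity is asked for doubling only; general multiples follow in
  \<open>homogeneous\<close>. The last clause bounds the growth under a fixed shift uniformly in the
  base point, which keeps directional derivatives finite.\<close>

definition homogeneous_superadditive :: "('a::comm_monoid_add \<Rightarrow> nat) \<Rightarrow> bool" where
  "homogeneous_superadditive f \<longleftrightarrow>
     (\<forall>a b. f a + f b \<le> f (a + b)) \<and> (\<forall>a. f (a + a) = 2 * f a) \<and> (\<forall>b. \<exists>K. \<forall>x. f (x + b) \<le> f x + K)"

definition linear_direction :: "('a::comm_monoid_add \<Rightarrow> nat) \<Rightarrow> 'a \<Rightarrow> bool" where
  "linear_direction f c \<longleftrightarrow> (\<forall>b. f (c + b) = f c + f b)"

text \<open>A bare commutative monoid has no scalar multiples, so \<open>N\<close> copies of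
  \<open>c\<close> added to \<open>b\<close> are written as the iterate
  \<open>((+) c ^^ N) b\<close>; the multiple itself is the iterate at 0.\<close>

lemma add_shift: "a + ((+) c ^^ N) b = ((+) c ^^ N) (a + b)"
  for c :: "'a::comm_monoid_add"
proof (induction N)
  case (Suc N)
  have "a + ((+) c ^^ Suc N) b = c + (a + ((+) c ^^ N) b)" by (simp add: add.left_commute)
  then show ?case by (simp add: Suc)
qed simp

lemma shift_add: "((+) c ^^ N) a + ((+) c ^^ M) b = ((+) c ^^ (N + M)) (a + b)"
  for c :: "'a::comm_monoid_add"
proof (induction N)
  case (Suc N)
  have "((+) c ^^ Suc N) a + ((+) c ^^ M) b = c + (((+) c ^^ N) a + ((+) c ^^ M) b)"
    by (simp add: add.assoc)
  then show ?case by (simp add: Suc)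
qed (simp add: add_shift)

lemma shift_zero_add: "((+) c ^^ N) b = ((+) c ^^ N) 0 + b" for c :: "'a::comm_monoid_add"
  using shift_add[of N c 0 0 b] by simp

section \<open>Homogeneity and directional derivatives\<close>

context
  fixes f :: "'a::comm_monoid_add \<Rightarrow> nat"
  assumes f: "homogeneous_superadditive f"
begin

lemma superadditive: "f a + f b \<le> f (a + b)"
  using f by (simp add: homogeneous_superadditive_def)

lemma zero_at_zero: "f 0 = 0"
  using f by (auto simp: homogeneous_superadditive_def dest: spec[of _ 0])

lemma shift_ge: "N * f c + f b \<le> f (((+) c ^^ N) b)"
proof (induction N)
  case (Suc N)
  then show ?case using superadditive[of c "((+) c ^^ N) b"] by simp
qed simp

lemma power_of_two: "f (((+) c ^^ (2 ^ k)) 0) = 2 ^ k * f c"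
proof (induction k)
  case (Suc k)
  have "((+) c ^^ (2 ^ k)) 0 + ((+) c ^^ (2 ^ k)) 0 = ((+) c ^^ (2 ^ Suc k)) 0"
    using shift_add[of "2 ^ k" c 0 "2 ^ k" 0] by (simp add: mult_2)
  then show ?case
    using f Suc unfolding homogeneous_superadditive_def by (metis mult.assoc power_Suc)
qed simp

text \<open>Powers of two are reached by doubling. For other \<open>N\<close>, the complement
  \<open>M\<close> of \<open>N\<close> in \<open>2 ^ N\<close> contributes at least
  \<open>M * f c\<close>, so any excess at \<open>N\<close> would push the value at
  \<open>2 ^ N\<close> too high.\<close>

lemma homogeneous: "f (((+) c ^^ N) 0) = N * f c"
proof (rule antisym)
  have "N \<le> 2 ^ N" by (simp add: less_imp_le)
  then obtain M where M: "2 ^ N = N + M" using le_Suc_ex by blast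
  have "f (((+) c ^^ N) 0) + f (((+) c ^^ M) 0) \<le> f (((+) c ^^ (2 ^ N)) 0)"
    using superadditive[of "((+) c ^^ N) 0" "((+) c ^^ M) 0"] by (simp only: shift_add M add_0)
  also have "\<dots> = N * f c + M * f c" unfolding power_of_two by (simp add: M algebra_simps)
  finally show "f (((+) c ^^ N) 0) \<le> N * f c"
    using shift_ge[of M c 0] zero_at_zero by simp
  show "N * f c \<le> f (((+) c ^^ N) 0)" using shift_ge[of N c 0] by simp
qed

text \<open>
  The directional derivative of \<open>f\<close> at \<open>\<infinity> \<cdot> c\<close>; the set is bounded and the
  truncated subtraction is exact by \<open>shift_ge\<close>.
\<close>
definition slope_at :: "'a \<Rightarrow> 'a \<Rightarrow> nat" where
  "slope_at c b = (SUP N. f (((+) c ^^ N) b) - N * f c)"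

lemma slope_bdd: "bdd_above (range (\<lambda>N. f (((+) c ^^ N) b) - N * f c))"
proof -
  obtain K where K: "\<And>x. f (x + b) \<le> f x + K"
    using f unfolding homogeneous_superadditive_def by blast
  \<comment> \<open>The growth constant of the shift by \<open>b\<close> is independent of the base
    point, so a single \<open>K\<close> serves all multiples of \<open>c\<close>.\<close>
  have "f (((+) c ^^ N) b) - N * f c \<le> K" for N
    using K[of "((+) c ^^ N) 0"] by (simp add: homogeneous flip: shift_zero_add)
  then show ?thesis by (intro bdd_aboveI[of _ K]) auto
qed

lemma slope_ge: "f (((+) c ^^ N) b) \<le> N * f c + slope_at c b"
  using cSUP_upper[OF _ slope_bdd[of c b], of N] by (simp add: slope_at_def)

lemma slope_le:
  assumes "\<And>N. f (((+) c ^^ N) b) \<le> N * f c + m"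
  shows "slope_at c b \<le> m"
  unfolding slope_at_def using assms by (intro cSUP_least) (auto simp: le_diff_conv add.commute)

text \<open>A bounded nonempty set of naturals has a maximum. Equalities at one suitable
  \<open>N\<close> therefore replace limits in the lemmas below.\<close>

lemma slope_attained: "\<exists>N. f (((+) c ^^ N) b) = N * f c + slope_at c b"
proof -
  let ?X = "range (\<lambda>N. f (((+) c ^^ N) b) - N * f c)"
  have "Max ?X \<in> ?X" using slope_bdd by (intro Max_in) (auto simp: bdd_above_nat)
  then have "slope_at c b \<in> ?X" by (simp add: slope_at_def Sup_nat_def)
  then obtain N where "slope_at c b = f (((+) c ^^ N) b) - N * f c" by auto
  then show ?thesis using shift_ge[of N c b] by (intro exI[of _ N]) auto
qed

lemma le_slope: "f b \<le> slope_at c b"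
  using slope_ge[of 0 c b] by simp

lemma slope_homogeneous_superadditive: "homogeneous_superadditive (slope_at c)"
  unfolding homogeneous_superadditive_def
proof (intro conjI allI)
  have sup: "slope_at c a + slope_at c b \<le> slope_at c (a + b)" for a b
  proof -
    obtain N M where "f (((+) c ^^ N) a) = N * f c + slope_at c a"
      "f (((+) c ^^ M) b) = M * f c + slope_at c b"
      using slope_attained by metis
    then have "(N + M) * f c + (slope_at c a + slope_at c b) \<le> f (((+) c ^^ (N + M)) (a + b))"
      using superadditive[of "((+) c ^^ N) a" "((+) c ^^ M) b"] by (simp add: shift_add algebra_simps)
    then show ?thesis using slope_ge[of "N + M" c "a + b"] by linarith
  qed
  then show "slope_at c a + slope_at c b \<le> slope_at c (a + b)" for a b .
  show "slope_at c (a + a) = 2 * slope_at c a" for a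
  proof (rule antisym)
    show "slope_at c (a + a) \<le> 2 * slope_at c a"
    proof (rule slope_le)
      fix N
      \<comment> \<open>With \<open>N\<close> further shifts the point becomes the double of
        \<open>((+) c ^^ N) a\<close>, where the doubling property applies; these shifts gain at
        least \<open>N * f c\<close>, which leaves the right bound.\<close>
      have "N * f c + f (((+) c ^^ N) (a + a)) \<le> f (((+) c ^^ N) (((+) c ^^ N) (a + a)))"
        by (rule shift_ge)
      also have "((+) c ^^ N) (((+) c ^^ N) (a + a)) = ((+) c ^^ N) a + ((+) c ^^ N) a"
        by (simp add: shift_add funpow_add)
      also have "f \<dots> = 2 * f (((+) c ^^ N) a)" using f by (simp add: homogeneous_superadditive_def)
      finally show "f (((+) c ^^ N) (a + a)) \<le> N * f c + 2 * slope_at c a"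
        using slope_ge[of N c a] by linarith
    qed
    show "2 * slope_at c a \<le> slope_at c (a + a)" using sup[of a a] by simp
  qed
  show "\<exists>K. \<forall>x. slope_at c (x + b) \<le> slope_at c x + K" for b
  proof -
    obtain K where K: "\<And>x. f (x + b) \<le> f x + K"
      using f unfolding homogeneous_superadditive_def by blast
    have "slope_at c (x + b) \<le> slope_at c x + K" for x
    proof (rule slope_le)
      fix N
      have "((+) c ^^ N) (x + b) = ((+) c ^^ N) x + b" using shift_add[of N c x 0 b] by simp
      then show "f (((+) c ^^ N) (x + b)) \<le> N * f c + (slope_at c x + K)"
        using K[of "((+) c ^^ N) x"] slope_ge[of N c x] by simp
    qed
    then show ?thesis by blast
  qed
qed

text \<open>Starting at \<open>c + b\<close> instead of \<open>b\<close> only renumbers the shifts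
  by one, so the supremum moves by exactly \<open>f c\<close>.\<close>

lemma slope_linear_direction: "slope_at c (c + b) = f c + slope_at c b"
proof (rule antisym)
  show "slope_at c (c + b) \<le> f c + slope_at c b"
    using slope_ge[of "Suc _" c b] by (intro slope_le) (simp add: funpow_swap1 add.assoc add.left_commute)
  obtain N where "f (((+) c ^^ N) b) = N * f c + slope_at c b" using slope_attained by metis
  moreover have "f c + f (((+) c ^^ N) b) \<le> f (((+) c ^^ N) (c + b))"
    using superadditive[of c "((+) c ^^ N) b"] by (simp add: funpow_swap1)
  ultimately show "f c + slope_at c b \<le> slope_at c (c + b)" using slope_ge[of N c "c + b"] by linarith
qed

text \<open>Additivity along \<open>e\<close> holds at every shifted point and hence passes to the
  supremum. Later derivatives thus keep the linear directions gained earlier.\<close>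

lemma slope_preserves_linear_direction:
  assumes e: "linear_direction f e"
  shows "slope_at c (e + b) = f e + slope_at c b"
proof -
  have *: "f (((+) c ^^ N) (e + b)) = f e + f (((+) c ^^ N) b)" for N
    using e shift_add[of 0 c e N b] by (auto simp: linear_direction_def dest: sym)
  show ?thesis
  proof (rule antisym)
    show "slope_at c (e + b) \<le> f e + slope_at c b"
      using slope_ge[of _ c b] by (intro slope_le) (simp add: * add.left_commute)
    obtain N where "f (((+) c ^^ N) b) = N * f c + slope_at c b" using slope_attained by metis
    then show "f e + slope_at c b \<le> slope_at c (e + b)"
      using slope_ge[of N c "e + b"] by (simp add: *)
  qed
qed

end

lemma linear_direction_value:
  assumes "homogeneous_superadditive f" "\<And>b. f (c + b) = K + f b"
  shows "linear_direction f c" "f c = K"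
  using assms(2)[of 0] zero_at_zero[OF assms(1)] assms(2) by (auto simp: linear_direction_def)

text \<open>One derivative is taken for each element of \<open>T\<close>. The last clause records
  that directions already linear stay so with unchanged values; this is what keeps the value at the
  chosen exponent fixed.\<close>

lemma ex_linear_directions:
  assumes f: "homogeneous_superadditive f" and "finite T"
  shows "\<exists>g. homogeneous_superadditive g \<and> (\<forall>b. f b \<le> g b) \<and> (\<forall>c\<in>T. linear_direction g c) \<and>
    (\<forall>c. linear_direction f c \<longrightarrow> linear_direction g c \<and> g c = f c)"
  using \<open>finite T\<close>
proof induction
  case empty
  then show ?case using f by auto
next
  case (insert c T)
  then obtain g where g: "homogeneous_superadditive g" "\<And>b. f b \<le> g b"
    "\<And>c. c \<in> T \<Longrightarrow> linear_direction g c"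
    "\<And>c. linear_direction f c \<Longrightarrow> linear_direction g c \<and> g c = f c" by blast
  let ?h = "slope_at g c"
  have h: "homogeneous_superadditive ?h" by (rule slope_homogeneous_superadditive[OF g(1)])
  have pres: "linear_direction ?h e" "?h e = g e" if "linear_direction g e" for e
    using linear_direction_value[OF h slope_preserves_linear_direction[OF g(1) that]] by auto
  have "linear_direction ?h c"
    using linear_direction_value[OF h slope_linear_direction[OF g(1)]] by auto
  moreover have "f b \<le> ?h b" for b using g(2)[of b] le_slope[OF g(1), of b c] by linarith
  ultimately show ?case using h pres g(3,4) by (intro exI[of _ ?h]) auto
qed

section \<open>Powers of upward closed sets of exponents\<close>

text \<open>If the monomials with exponents in \<open>E\<close> generate an ideal, these are the
  exponents of the monomials in its \<open>n\<close>-th power. The cofactor \<open>c\<close> is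
  unrestricted; the bound on the variables enters only with \<open>monomial_ideal\<close>.\<close>

definition upow :: "'a::comm_monoid_add set \<Rightarrow> nat \<Rightarrow> 'a set" where
  "upow E n = {sum_list xs + c | xs c. set xs \<subseteq> E \<and> length xs = n}"

lemma upowI: "set xs \<subseteq> E \<Longrightarrow> length xs = n \<Longrightarrow> a = sum_list xs + c \<Longrightarrow> a \<in> upow E n"
  by (auto simp: upow_def)

lemma upow_0 [simp]: "upow E 0 = UNIV"
  by (auto simp: upow_def)

lemma upow_add:
  assumes "a \<in> upow E n" "b \<in> upow E m"
  shows "a + b \<in> upow E (n + m)"
proof -
  obtain xs c ys e where "set xs \<subseteq> E" "length xs = n" "a = sum_list xs + c"
    "set ys \<subseteq> E" "length ys = m" "b = sum_list ys + e"
    using assms by (auto simp: upow_def)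
  then show ?thesis by (intro upowI[of "xs @ ys" _ _ _ "c + e"]) (auto simp: ac_simps)
qed

lemma upow_up: "a \<in> upow E n \<Longrightarrow> a + b \<in> upow E n"
  using upow_add[of a E n b 0] by simp

lemma upow_mono:
  assumes "a \<in> upow E n" "m \<le> n"
  shows "a \<in> upow E m"
proof -
  obtain xs c where *: "set xs \<subseteq> E" "length xs = n" "a = sum_list xs + c"
    using assms by (auto simp: upow_def)
  have "a = sum_list (take m xs) + (sum_list (drop m xs) + c)"
    by (simp add: * flip: add.assoc sum_list_append)
  then show ?thesis
    using * assms set_take_subset[of m xs] by (intro upowI[of "take m xs"]) auto
qed

lemma upow_Suc: "upow E (Suc n) = {F + b | F b. F \<in> E \<and> b \<in> upow E n}"
proof safe
  fix a assume "a \<in> upow E (Suc n)"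
  then obtain xs c where *: "set xs \<subseteq> E" "length xs = Suc n" "a = sum_list xs + c"
    by (auto simp: upow_def)
  then obtain F ys where "xs = F # ys" by (cases xs) auto
  with * show "\<exists>F b. a = F + b \<and> F \<in> E \<and> b \<in> upow E n"
    by (intro exI[of _ F] exI[of _ "sum_list ys + c"]) (auto simp: ac_simps intro!: upowI)
next
  fix F b assume "F \<in> E" "b \<in> upow E n"
  then show "F + b \<in> upow E (Suc n)"
    using upow_add[of F E 1 b n] upowI[of "[F]" E 1 F 0] by auto
qed

lemma upow_1: "a \<in> upow E 1 \<longleftrightarrow> (\<exists>F\<in>E. \<exists>b. a = F + b)"
  unfolding One_nat_def upow_Suc by auto

lemma upow_pigeonhole:
  assumes "finite E" "card E < n" "a \<in> upow E n"
  shows "\<exists>F\<in>E. \<exists>b\<in>upow E (n - 2). a = F + F + b"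
proof -
  obtain xs c where *: "set xs \<subseteq> E" "length xs = n" "a = sum_list xs + c"
    using assms by (auto simp: upow_def)
  have "\<not> distinct xs"
    using assms(1,2) * card_mono[of E "set xs"] distinct_card[of xs] by auto
  then obtain ps F qs rs where xs: "xs = ps @ [F] @ qs @ [F] @ rs"
    using not_distinct_decomp by blast
  have "sum_list (ps @ qs @ rs) + c \<in> upow E (n - 2)"
    using * xs by (intro upowI[of "ps @ qs @ rs"]) auto
  moreover have "a = F + F + (sum_list (ps @ qs @ rs) + c)"
    using * xs by (simp add: ac_simps)
  ultimately show ?thesis using * xs by auto
qed

text \<open>A finitely supported vector is a finite sum of unit vectors from its support, so it is
  reached by adding one unit at a time; \<open>K\<close> confines these units to the allowed
  variables.\<close>

lemma exponent_induct [consumes 1, case_names zero add]: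
  fixes a :: "'i \<Rightarrow>\<^sub>0 nat"
  assumes "Poly_Mapping.keys a \<subseteq> K" and "P 0"
    and step: "\<And>b i. i \<in> K \<Longrightarrow> P b \<Longrightarrow> P (Poly_Mapping.single i 1 + b)"
  shows "P a"
proof -
  have "P (\<Sum>i\<in>A. Poly_Mapping.single i (Poly_Mapping.lookup a i))" if "finite A" "A \<subseteq> K" for A
    using that
  proof (induction A rule: finite_induct)
    case (insert i A)
    have "P (Poly_Mapping.single i n + (\<Sum>i\<in>A. Poly_Mapping.single i (Poly_Mapping.lookup a i)))" for n
    proof (induction n)
      case (Suc n)
      have "Poly_Mapping.single i (Suc n) = Poly_Mapping.single i 1 + Poly_Mapping.single i n"
        by (simp flip: single_add)
      then show ?case using step[OF _ Suc] insert.prems by (simp add: add.assoc)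
    qed (use insert in auto)
    then show ?case using insert.hyps by simp
  qed (use \<open>P 0\<close> in simp)
  moreover have "(\<Sum>i\<in>Poly_Mapping.keys a. Poly_Mapping.single i (Poly_Mapping.lookup a i)) = a"
    by (rule poly_mapping_eqI) (auto simp: lookup_sum lookup_single when_def in_keys_iff)
  ultimately show ?thesis using assms(1) by (metis finite_keys)
qed

section \<open>Weights and vertex covers\<close>

definition weight :: "'i set \<Rightarrow> ('i \<Rightarrow>\<^sub>0 nat) \<Rightarrow> nat" where
  "weight C a = (\<Sum>i\<in>C. Poly_Mapping.lookup a i)"

lemma weight_add [simp]: "weight C (a + b) = weight C a + weight C b"
  by (simp add: weight_def lookup_add sum.distrib)

lemma weight_zero [simp]: "weight C 0 = 0"
  by (simp add: weight_def)

lemma weight_pos_iff: "finite C \<Longrightarrow> 0 < weight C a \<longleftrightarrow> C \<inter> Poly_Mapping.keys a \<noteq> {}"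
  by (auto simp: weight_def in_keys_iff simp flip: neq0_conv)

definition is_cover :: "('i \<Rightarrow>\<^sub>0 nat) set \<Rightarrow> 'i set \<Rightarrow> bool" where
  "is_cover E C \<longleftrightarrow> (\<forall>F\<in>E. C \<inter> Poly_Mapping.keys F \<noteq> {})"

text \<open>Each factor from \<open>E\<close> contributes at least one to the weight of a cover.
  This is the inequality \<nu> \<le> \<tau>.\<close>

lemma upow_weight:
  assumes "finite C" "is_cover E C" "a \<in> upow E n"
  shows "n \<le> weight C a"
  using assms(3)
proof (induction n arbitrary: a)
  case (Suc n)
  then obtain F b where "a = F + b" "F \<in> E" "b \<in> upow E n" by (auto simp: upow_Suc)
  then show ?case using Suc.IH[of b] weight_pos_iff[OF assms(1), of F] assms(2)
    by (auto simp: is_cover_def)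
qed simp

lemma split_unit:
  assumes "Poly_Mapping.lookup a i \<noteq> 0"
  obtains b where "a = Poly_Mapping.single i (1::nat) + b"
proof
  show "a = Poly_Mapping.single i 1 + (a - Poly_Mapping.single i 1)"
    using assms by (intro poly_mapping_eqI) (auto simp: lookup_add lookup_minus lookup_single when_def)
qed

text \<open>Removing one unit costs at most one factor: the unit is taken from the cofactor if
  possible, and otherwise from a factor whose remainder joins the cofactor.\<close>

lemma upow_remove_unit:
  assumes "Poly_Mapping.single i (1::nat) + x \<in> upow E (Suc n)"
  shows "x \<in> upow E n"
proof -
  obtain xs c where *: "set xs \<subseteq> E" "length xs = Suc n" "Poly_Mapping.single i 1 + x = sum_list xs + c"
    using assms by (auto simp: upow_def)
  show ?thesis
  proof (cases "Poly_Mapping.lookup c i = 0")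
    case False
    then obtain c' where "c = Poly_Mapping.single i 1 + c'" by (rule split_unit)
    with * have "Poly_Mapping.single i 1 + x = Poly_Mapping.single i 1 + (sum_list xs + c')"
      by (metis add.left_commute)
    then have "x = sum_list xs + c'" by (simp only: add_left_cancel)
    then have "x \<in> upow E (Suc n)" using * by (intro upowI) auto
    then show ?thesis by (rule upow_mono) simp
  next
    case True
    have zero: "Poly_Mapping.lookup (sum_list xs) i = 0" if "\<forall>F\<in>set xs. Poly_Mapping.lookup F i = 0"
      using that by (induction xs) (auto simp: lookup_add)
    have "Poly_Mapping.lookup (sum_list xs) i \<noteq> 0"
      using arg_cong[OF *(3), of "\<lambda>p. Poly_Mapping.lookup p i"] True by (simp add: lookup_add)
    then obtain F where F: "F \<in> set xs" "Poly_Mapping.lookup F i \<noteq> 0" using zero by metis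
    obtain F' where F': "F = Poly_Mapping.single i 1 + F'" using F(2) by (rule split_unit)
    obtain ys zs where xs: "xs = ys @ F # zs" using F(1) by (meson split_list)
    have "Poly_Mapping.single i 1 + x = Poly_Mapping.single i 1 + (sum_list (ys @ zs) + (F' + c))"
      using * by (simp add: xs F' ac_simps)
    then have "x = sum_list (ys @ zs) + (F' + c)" by (simp only: add_left_cancel)
    then show ?thesis using * xs by (intro upowI[of "ys @ zs"]) auto
  qed
qed

text \<open>Supplies the uniform growth bound for \<nu>, with one lost factor for each unit in
  \<open>b\<close>.\<close>

lemma upow_remove: "\<exists>K. \<forall>x n. x + b \<in> upow E (n + K) \<longrightarrow> x \<in> upow E n"
  for b :: "'i \<Rightarrow>\<^sub>0 nat"
proof -
  have "Poly_Mapping.keys b \<subseteq> UNIV" by simp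
  then show ?thesis
  proof (induction b rule: exponent_induct)
    case zero
    show ?case by (intro exI[of _ 0]) auto
  next
    case (add b i)
    then obtain K where "\<And>x n. x + b \<in> upow E (n + K) \<Longrightarrow> x \<in> upow E n" by blast
    then have "x \<in> upow E n" if "x + (Poly_Mapping.single i 1 + b) \<in> upow E (n + Suc K)" for x n
      using that upow_remove_unit[of i "x + b" E "n + K"] by (simp add: add.left_commute)
    then show ?case by blast
  qed
qed

lemma upow_half:
  fixes E :: "('i \<Rightarrow>\<^sub>0 nat) set"
  assumes "finite E"
    and small: "\<And>a m. 2 * m + 1 \<le> card E \<Longrightarrow> a + a \<in> upow E (2 * m + 1) \<Longrightarrow> a \<in> upow E (Suc m)"
  shows "a + a \<in> upow E (2 * m + 1) \<Longrightarrow> a \<in> upow E (Suc m)"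
proof (induction m arbitrary: a)
  case (Suc m)
  show ?case
  proof (cases "2 * Suc m + 1 \<le> card E")
    case False
    then obtain F b where Fb: "F \<in> E" "b \<in> upow E (2 * m + 1)" "a + a = F + F + b"
      using upow_pigeonhole[OF assms(1) _ Suc.prems] by auto
    \<comment> \<open>Since \<open>2F\<close> is at most \<open>2a\<close> in each coordinate,
      \<open>F\<close> is at most \<open>a\<close>. The truncated difference \<open>a - F\<close> is
      therefore exact, and \<open>b\<close> is its double.\<close>
    have le: "2 * Poly_Mapping.lookup a i = 2 * Poly_Mapping.lookup F i + Poly_Mapping.lookup b i" for i
      using arg_cong[OF Fb(3), of "\<lambda>p. Poly_Mapping.lookup p i"] by (simp add: lookup_add)
    define a' where "a' = a - F"
    have a: "a = F + a'"
    proof (rule poly_mapping_eqI)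
      show "Poly_Mapping.lookup a i = Poly_Mapping.lookup (F + a') i" for i
        using le[of i] by (simp add: a'_def lookup_add lookup_minus)
    qed
    have "F + F + (a' + a') = F + F + b" using Fb(3) by (simp add: a ac_simps)
    then have "a' + a' \<in> upow E (2 * m + 1)" using Fb(2) by simp
    then have "a' \<in> upow E (Suc m)" by (rule Suc.IH)
    then show ?thesis using Fb(1) by (auto simp: a upow_Suc[of E "Suc m"])
  qed (use small Suc.prems in blast)
next
  case 0
  show ?case
  \<comment> \<open>At \<open>m = 0\<close> the bound \<open>2 * m + 1 \<le> card E\<close> fails
    only for empty \<open>E\<close>, and then \<open>upow E 1\<close> is empty.\<close>
  proof (cases "card E = 0")
    case True
    then have "E = {}" using assms(1) by simp
    then show ?thesis using 0 by (simp add: upow_Suc)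
  next
    case False
    then show ?thesis using small[of 0 a] 0 by simp
  qed
qed

lemma linear_direction_exponent:
  fixes f :: "('i \<Rightarrow>\<^sub>0 nat) \<Rightarrow> nat"
  assumes "f 0 = 0" "\<And>i. i \<in> K \<Longrightarrow> linear_direction f (Poly_Mapping.single i 1)"
    "Poly_Mapping.keys b \<subseteq> K" "finite K"
  shows "f b = (\<Sum>i\<in>K. Poly_Mapping.lookup b i * f (Poly_Mapping.single i 1))"
  using assms(3)
proof (induction b rule: exponent_induct)
  case zero
  then show ?case using assms(1) by simp
next
  case (add b i)
  then have "f (Poly_Mapping.single i 1 + b) = f (Poly_Mapping.single i 1) + f b"
    using assms(2) by (auto simp: linear_direction_def)
  moreover have "(\<Sum>j\<in>K. Poly_Mapping.lookup (Poly_Mapping.single i 1) j * f (Poly_Mapping.single j 1)) =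
      (\<Sum>j\<in>K. if i = j then f (Poly_Mapping.single j 1) else 0)"
    by (intro sum.cong) (auto simp: lookup_single)
  ultimately show ?case using add assms(4)
    by (simp add: lookup_add add_mult_distrib sum.distrib)
qed

text \<open>The combinatorial core, free of rings: \<open>small\<close> is the hypothesis \<tau>
  \<ge> m + 1 implies \<nu> \<ge> m + 1 in the range below \<open>card E\<close>, and the conclusion
  is \<tau> \<le> \<nu> without a bound on the exponent.\<close>

lemma upow_eq_cover_weight:
  fixes E :: "(nat \<Rightarrow>\<^sub>0 nat) set"
  assumes "finite E" and E: "\<And>F. F \<in> E \<Longrightarrow> Poly_Mapping.keys F \<subseteq> {..<d}"
    and small: "\<And>a m. 2 * m + 1 \<le> card E \<Longrightarrow>
      (\<And>C. C \<subseteq> {..<d} \<Longrightarrow> is_cover E C \<Longrightarrow> Suc m \<le> weight C a) \<Longrightarrow> a \<in> upow E (Suc m)"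
    and a: "Poly_Mapping.keys a \<subseteq> {..<d}"
    and weight: "\<And>C. C \<subseteq> {..<d} \<Longrightarrow> is_cover E C \<Longrightarrow> n \<le> weight C a"
  shows "a \<in> upow E n"
\<comment> \<open>With \<open>0 \<in> E\<close> the ideal is the whole ring: no cover exists and
  \<nu> would be infinite, so this case is treated apart.\<close>
proof (cases "0 \<in> E")
  case True
  have "b \<in> upow E n" for b
    using True by (induction n) (force simp: upow_Suc)+
  then show ?thesis .
next
  case False
  have half: "b \<in> upow E (Suc m)" if "b + b \<in> upow E (2 * m + 1)" for b m
    using that
  proof (rule upow_half[OF assms(1), rotated])
    fix a m assume *: "2 * m + 1 \<le> card E" "a + a \<in> upow E (2 * m + 1)"
    show "a \<in> upow E (Suc m)"
    proof (rule small)
      fix C assume C: "C \<subseteq> {..<d}" "is_cover E C"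
      show "Suc m \<le> weight C a"
        \<comment> \<open>The weight of \<open>a + a\<close> is even and at least
          \<open>2 * m + 1\<close>, so half of it rounds up to \<open>m + 1\<close>.\<close>
        using upow_weight[OF _ C(2) *(2)] finite_subset[OF C(1)] by simp
    qed fact
  qed
  \<comment> \<open>The weight of this cover bounds the set of \<open>n\<close> whose maximum
    defines \<nu>.\<close>
  have cov: "is_cover E {..<d}"
    unfolding is_cover_def
  proof
    fix F assume "F \<in> E"
    then have "F \<noteq> 0" "Poly_Mapping.keys F \<subseteq> {..<d}" using E False by auto
    then show "{..<d} \<inter> Poly_Mapping.keys F \<noteq> {}" by (simp add: Int_absorb1)
  qed
  define \<nu> where "\<nu> a = Max {n. a \<in> upow E n}" for a
  have fin: "finite {n. a \<in> upow E n}" for a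
  proof (rule finite_subset)
    show "{n. a \<in> upow E n} \<subseteq> {..weight {..<d} a}"
      using upow_weight[OF finite_lessThan cov] by blast
  qed simp
  have nu: "a \<in> upow E n \<longleftrightarrow> n \<le> \<nu> a" for a n
  proof
    have "0 \<in> {n. a \<in> upow E n}" by simp
    then have "\<nu> a \<in> {n. a \<in> upow E n}" unfolding \<nu>_def using Max_in[OF fin] by blast
    then show "a \<in> upow E n" if "n \<le> \<nu> a" using upow_mono[OF _ that] by simp
    show "n \<le> \<nu> a" if "a \<in> upow E n" unfolding \<nu>_def using Max_ge[OF fin] that by simp
  qed
  have hom: "homogeneous_superadditive \<nu>"
    unfolding homogeneous_superadditive_def
  proof (intro conjI allI)
    show sup: "\<nu> a + \<nu> b \<le> \<nu> (a + b)" for a b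
      using upow_add nu by blast
    show "\<nu> (a + a) = 2 * \<nu> a" for a
    proof (rule ccontr)
      assume "\<nu> (a + a) \<noteq> 2 * \<nu> a"
      \<comment> \<open>Superadditivity excludes a deficit, and \<open>half\<close> turns an excess
        of one into membership of \<open>a\<close> at exponent \<open>\<nu> a + 1\<close>, against
        maximality.\<close>
      then have "2 * \<nu> a + 1 \<le> \<nu> (a + a)" using sup[of a a] by simp
      then show False using half[of a "\<nu> a"] nu by fastforce
    qed
    show "\<exists>K. \<forall>x. \<nu> (x + b) \<le> \<nu> x + K" for b
    proof -
      obtain K where K: "\<And>x n. x + b \<in> upow E (n + K) \<Longrightarrow> x \<in> upow E n" using upow_remove by blast
      have "\<nu> (x + b) \<le> \<nu> x + K" for x
      proof (cases "\<nu> (x + b) \<le> K")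
        case False
        then show ?thesis using K[of x "\<nu> (x + b) - K"] nu by fastforce
      qed simp
      then show ?thesis by blast
    qed
  qed
  \<comment> \<open>The first derivative goes in the direction \<open>a\<close> itself, so that its
    value at \<open>a\<close> is still \<open>\<nu> a\<close>; the unit directions come afterwards
    and keep that value.\<close>
  define f0 where "f0 = slope_at \<nu> a"
  have f0: "homogeneous_superadditive f0" "\<And>b. \<nu> b \<le> f0 b"
    unfolding f0_def by (rule slope_homogeneous_superadditive[OF hom], rule le_slope[OF hom])
  have f0a: "linear_direction f0 a" "f0 a = \<nu> a"
    using linear_direction_value[OF f0(1), of a "\<nu> a"] slope_linear_direction[OF hom]
    by (auto simp: f0_def)
  have "finite ((\<lambda>i. Poly_Mapping.single i (1::nat)) ` {..<d})" by simp
  from ex_linear_directions[OF f0(1) this]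
  obtain f where f: "homogeneous_superadditive f" "\<And>b. f0 b \<le> f b" "f a = f0 a"
    "\<And>i. i < d \<Longrightarrow> linear_direction f (Poly_Mapping.single i 1)"
    using f0a(1) by auto
  have val: "f b = (\<Sum>i<d. Poly_Mapping.lookup b i * f (Poly_Mapping.single i 1))"
    if "Poly_Mapping.keys b \<subseteq> {..<d}" for b
    using f(4) that by (intro linear_direction_exponent zero_at_zero[OF f(1)]) auto
  \<comment> \<open>Each \<open>F\<close> in \<open>E\<close> has
    \<open>f F \<ge> \<nu> F \<ge> 1\<close>, so some variable in its support has a positive
    coefficient. Coefficients are natural numbers, so those on \<open>C\<close> are at least one and
    the weight of \<open>C\<close> at \<open>a\<close> is at most \<open>f a\<close>.\<close>
  define C where "C = {i. i < d \<and> f (Poly_Mapping.single i 1) > 0}"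
  have "is_cover E C"
    unfolding is_cover_def
  proof
    fix F assume F: "F \<in> E"
    then have "F \<in> upow E 1" using upowI[of "[F]" E 1 F 0] by simp
    then have "0 < f F" using nu[of F 1] f0(2)[of F] f(2)[of F] by simp
    then show "C \<inter> Poly_Mapping.keys F \<noteq> {}"
      using val[OF E[OF F]] by (auto simp: C_def in_keys_iff simp flip: neq0_conv)
  qed
  then have "n \<le> weight C a" using weight[of C] by (auto simp: C_def)
  also have "weight C a = (\<Sum>i\<in>C. Poly_Mapping.lookup a i * 1)" by (simp add: weight_def)
  also have "\<dots> \<le> (\<Sum>i\<in>C. Poly_Mapping.lookup a i * f (Poly_Mapping.single i 1))"
    by (intro sum_mono mult_left_mono) (auto simp: C_def)
  also have "\<dots> \<le> f a" unfolding val[OF a] by (intro sum_mono2) (auto simp: C_def)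
  finally show ?thesis using nu f(3) f0a(2) by simp
qed

section \<open>Monomial ideals\<close>

lemma ring_of_type_algebra_simps [simp]:
  "x \<otimes>\<^bsub>ring_of_type_algebra\<^esub> y = x * y" "x \<oplus>\<^bsub>ring_of_type_algebra\<^esub> y = x + y"
  "\<one>\<^bsub>ring_of_type_algebra\<^esub> = 1" "\<zero>\<^bsub>ring_of_type_algebra\<^esub> = 0"
  by (simp_all add: ring_of_type_algebra_def)

text \<open>Closure under negation comes from multiplication by \<open>- 1\<close>, which lies in
  \<open>C\<close> because the additive inverse of one in the ring \<open>R\<close> must agree with
  that of the type.\<close>

lemma ideal_of_type_subsetI:
  fixes C J :: "'a::comm_ring_1 set"
  defines "R \<equiv> ring_of_type_algebra\<lparr>carrier := C\<rparr>"
  assumes "ring R" "J \<subseteq> C" "0 \<in> J" and add: "\<And>x y. x \<in> J \<Longrightarrow> y \<in> J \<Longrightarrow> x + y \<in> J"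
    and mult: "\<And>x y. x \<in> C \<Longrightarrow> y \<in> J \<Longrightarrow> x * y \<in> J"
  shows "ideal J R"
proof -
  interpret R: ring R by fact
  have carr: "carrier R = C" by (simp add: R_def)
  have one: "1 \<in> carrier R" using R.one_closed by (simp add: R_def)
  have "\<ominus>\<^bsub>R\<^esub> 1 + 1 = 0" using R.l_neg[OF one] by (simp add: R_def)
  then have "\<ominus>\<^bsub>R\<^esub> 1 = - 1" by (simp only: eq_neg_iff_add_eq_0)
  then have m1: "- 1 \<in> C" using R.a_inv_closed[OF one] by (simp add: carr)
  have mult': "x * y \<in> J" if "x \<in> J" "y \<in> C" for x y
    using mult[OF that(2,1)] by (simp only: mult.commute)
  show ?thesis
  proof (rule idealI)
    show "subgroup J (add_monoid R)"
    proof (rule R.add.subgroupI)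
      fix x assume x: "x \<in> J"
      then have "- x \<in> J" using mult[OF m1 x] by simp
      moreover have "\<ominus>\<^bsub>R\<^esub> x = - x"
        by (rule R.minus_equality) (use x \<open>- x \<in> J\<close> assms(3) in \<open>auto simp: R_def\<close>)
      ultimately show "\<ominus>\<^bsub>R\<^esub> x \<in> J" by simp
    qed (use assms in \<open>auto simp: R_def\<close>)
  next
    show "ring R" by fact
  qed (use mult mult' in \<open>auto simp: R_def\<close>)
qed

lemma mpoly_ring_simps [simp]:
  fixes x y :: "'k::field mpoly"
  shows "x \<otimes>\<^bsub>mpoly_ring d\<^esub> y = x * y" "x \<oplus>\<^bsub>mpoly_ring d\<^esub> y = x + y"
    "\<one>\<^bsub>mpoly_ring d\<^esub> = (1 :: 'k mpoly)" "\<zero>\<^bsub>mpoly_ring d\<^esub> = (0 :: 'k mpoly)"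
  by (simp_all add: mpoly_ring_def)

lemma carrier_mpoly_ring:
  "carrier (mpoly_ring d) = {f. \<forall>a\<in>Poly_Mapping.keys f. Poly_Mapping.keys a \<subseteq> {..<d}}"
  by (simp add: mpoly_ring_def)

lemma ideal_mpoly_ringI:
  fixes J :: "'k::field mpoly set"
  assumes "J \<subseteq> carrier (mpoly_ring d)" "0 \<in> J" "\<And>x y. x \<in> J \<Longrightarrow> y \<in> J \<Longrightarrow> x + y \<in> J"
    "\<And>x y. x \<in> carrier (mpoly_ring d) \<Longrightarrow> y \<in> J \<Longrightarrow> x * y \<in> J"
  shows "ideal J (mpoly_ring d)"
  unfolding mpoly_ring_def
proof (rule ideal_of_type_subsetI)
  show "ring (ring_of_type_algebra\<lparr>carrier :=
      {f :: 'k mpoly. \<forall>a\<in>Poly_Mapping.keys f. Poly_Mapping.keys a \<subseteq> {..<d}}\<rparr>)"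
    using domain_mpoly_ring[where 'k = 'k, of d] by (simp add: mpoly_ring_def domain_def cring_def)
qed (use assms in \<open>auto simp: carrier_mpoly_ring\<close>)

lemma ideal_mpoly_ringD:
  fixes J :: "'k::field mpoly set"
  assumes "ideal J (mpoly_ring d)"
  shows "J \<subseteq> carrier (mpoly_ring d)" "0 \<in> J" "\<And>x y. x \<in> J \<Longrightarrow> y \<in> J \<Longrightarrow> x + y \<in> J"
    "\<And>x y. x \<in> carrier (mpoly_ring d) \<Longrightarrow> y \<in> J \<Longrightarrow> x * y \<in> J"
proof -
  interpret ideal J "mpoly_ring d" by fact
  show "J \<subseteq> carrier (mpoly_ring d)" by (rule a_subset)
  show "0 \<in> J" using additive_subgroup.zero_closed[OF ideal.axioms(1)[OF assms]] by simp
  show "\<And>x y. x \<in> J \<Longrightarrow> y \<in> J \<Longrightarrow> x + y \<in> J"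
    using additive_subgroup.a_closed[OF ideal.axioms(1)[OF assms]] by simp
  show "\<And>x y. x \<in> carrier (mpoly_ring d) \<Longrightarrow> y \<in> J \<Longrightarrow> x * y \<in> J" using I_l_closed by simp
qed

section \<open>Monomial ideals and their powers\<close>

abbreviation xpow :: "(nat \<Rightarrow>\<^sub>0 nat) \<Rightarrow> 'k::field mpoly" where
  "xpow a \<equiv> Poly_Mapping.single a 1"

text \<open>\<open>U\<close> may contain exponents that involve variables beyond \<open>d\<close>;
  the carrier discards them. The set is an ideal once \<open>U\<close> is closed upward.\<close>

definition monomial_ideal :: "nat \<Rightarrow> (nat \<Rightarrow>\<^sub>0 nat) set \<Rightarrow> 'k::field mpoly set" where
  "monomial_ideal d U = {f \<in> carrier (mpoly_ring d). Poly_Mapping.keys f \<subseteq> U}"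

lemma keys_add_nat: "Poly_Mapping.keys (a + b) = Poly_Mapping.keys a \<union> Poly_Mapping.keys b"
  for a b :: "'i \<Rightarrow>\<^sub>0 nat"
  by (auto simp: in_keys_iff lookup_add)

lemma xpow_in_carrier_iff: "xpow a \<in> carrier (mpoly_ring d) \<longleftrightarrow> Poly_Mapping.keys a \<subseteq> {..<d}"
  by (simp add: carrier_mpoly_ring)

lemma xpow_in_monomial_ideal_iff:
  "xpow a \<in> monomial_ideal d U \<longleftrightarrow> Poly_Mapping.keys a \<subseteq> {..<d} \<and> a \<in> U"
  by (simp add: monomial_ideal_def carrier_mpoly_ring)

lemma xpow_add: "xpow (a + b) = xpow a * xpow b"
  by (simp add: mult_single)

lemma carrier_mult_closed:
  fixes f g :: "'k::field mpoly"
  assumes "f \<in> carrier (mpoly_ring d)" "g \<in> carrier (mpoly_ring d)"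
  shows "f * g \<in> carrier (mpoly_ring d)"
proof -
  interpret domain "mpoly_ring d :: 'k mpoly ring" by (rule domain_mpoly_ring)
  show ?thesis using m_closed[OF assms] by simp
qed

lemma carrier_add_closed:
  fixes f g :: "'k::field mpoly"
  assumes "f \<in> carrier (mpoly_ring d)" "g \<in> carrier (mpoly_ring d)"
  shows "f + g \<in> carrier (mpoly_ring d)"
proof -
  interpret domain "mpoly_ring d :: 'k mpoly ring" by (rule domain_mpoly_ring)
  show ?thesis using a_closed[OF assms] by simp
qed

lemma ideal_monomial_ideal:
  assumes up: "\<And>a b. a \<in> U \<Longrightarrow> a + b \<in> U"
  shows "ideal (monomial_ideal d U :: 'k::field mpoly set) (mpoly_ring d)"
proof (rule ideal_mpoly_ringI)
  fix x y :: "'k mpoly" assume "x \<in> monomial_ideal d U" "y \<in> monomial_ideal d U"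
  then show "x + y \<in> monomial_ideal d U"
    using Poly_Mapping.keys_add[of x y] carrier_add_closed by (auto simp: monomial_ideal_def)
next
  fix x y :: "'k mpoly" assume *: "x \<in> carrier (mpoly_ring d)" "y \<in> monomial_ideal d U"
  then have "Poly_Mapping.keys (x * y) \<subseteq> U"
    using keys_mult[of x y] up by (fastforce simp: monomial_ideal_def add.commute)
  then show "x * y \<in> monomial_ideal d U"
    using * carrier_mult_closed by (auto simp: monomial_ideal_def)
qed (auto simp: monomial_ideal_def carrier_mpoly_ring)

lemma lookup_sum_single:
  "finite A \<Longrightarrow> Poly_Mapping.lookup (\<Sum>a\<in>A. Poly_Mapping.single a (h a)) b = (if b \<in> A then h b else 0)"
  by (simp add: lookup_sum lookup_single when_def)

lemma sum_keys_single: "(\<Sum>a\<in>Poly_Mapping.keys f. Poly_Mapping.single a (Poly_Mapping.lookup f a)) = f"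
  by (rule poly_mapping_eqI) (simp add: lookup_sum_single in_keys_iff)

text \<open>A polynomial is the sum of its terms, and each term is a constant times a monomial.
  Containment in an ideal can thus be tested on monomials.\<close>

lemma monomial_ideal_subset:
  fixes J :: "'k::field mpoly set"
  assumes J: "ideal J (mpoly_ring d)"
    and xpow: "\<And>a. a \<in> U \<Longrightarrow> Poly_Mapping.keys a \<subseteq> {..<d} \<Longrightarrow> xpow a \<in> J"
  shows "monomial_ideal d U \<subseteq> J"
proof
  fix f :: "'k mpoly" assume f: "f \<in> monomial_ideal d U"
  have "(\<Sum>a\<in>A. Poly_Mapping.single a (Poly_Mapping.lookup f a)) \<in> J"
    if "finite A" "A \<subseteq> Poly_Mapping.keys f" for A
    using that
  proof (induction A rule: finite_induct)
    case (insert a A)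
    then have "a \<in> U" "Poly_Mapping.keys a \<subseteq> {..<d}"
      using f by (auto simp: monomial_ideal_def carrier_mpoly_ring)
    then have "Poly_Mapping.single 0 (Poly_Mapping.lookup f a) * xpow a \<in> J"
      using xpow by (intro ideal_mpoly_ringD(4)[OF J]) (auto simp: carrier_mpoly_ring)
    then show ?case using insert ideal_mpoly_ringD(3)[OF J] by (simp add: mult_single)
  qed (use ideal_mpoly_ringD(2)[OF J] in simp)
  from this[OF finite_keys order_refl] show "f \<in> J" by (simp add: sum_keys_single)
qed

text \<open>Exponents add in products, which gives one inclusion. For the other, a monomial of level
  \<open>n + 1\<close> splits off a single generator. The zeroth power is the whole ring, matching
  \<open>upow E 0 = UNIV\<close>.\<close>

lemma monomial_ideal_power:
  fixes E d
  defines "I \<equiv> monomial_ideal d (upow E 1) :: 'k::field mpoly set"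
  shows "I [^]\<^bsub>ideals_set (mpoly_ring d)\<^esub> n = monomial_ideal d (upow E n)"
proof (induction n)
  case 0
  show ?case by (simp add: nat_pow_def ideals_set_def monomial_ideal_def)
next
  case (Suc n)
  interpret R: domain "mpoly_ring d :: 'k mpoly ring" by (rule domain_mpoly_ring)
  let ?I = "\<lambda>n. monomial_ideal d (upow E n) :: 'k mpoly set"
  have id: "ideal (?I n) (mpoly_ring d)" for n
    by (intro ideal_monomial_ideal upow_up)
  have "I [^]\<^bsub>ideals_set (mpoly_ring d)\<^esub> Suc n = ideal_prod (mpoly_ring d) (?I n) (?I 1)"
    using Suc by (simp add: nat_pow_def ideals_set_def I_def)
  also have "\<dots> = ?I (Suc n)"
  proof
    show "ideal_prod (mpoly_ring d) (?I n) (?I 1) \<subseteq> ?I (Suc n)"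
    proof
      fix f :: "'k mpoly" assume "f \<in> ideal_prod (mpoly_ring d) (?I n) (?I 1)"
      then show "f \<in> ?I (Suc n)"
      proof induction
        case (prod f g)
        then have "Poly_Mapping.keys (f * g) \<subseteq> upow E (Suc n)"
          using keys_mult[of f g] upow_add[of _ E n _ 1] by (fastforce simp: monomial_ideal_def)
        then show ?case using prod carrier_mult_closed by (auto simp: monomial_ideal_def)
      next
        case (sum f g)
        then show ?case using ideal_mpoly_ringD(3)[OF id] by simp
      qed
    qed
    show "?I (Suc n) \<subseteq> ideal_prod (mpoly_ring d) (?I n) (?I 1)"
    proof (rule monomial_ideal_subset)
      show "ideal (ideal_prod (mpoly_ring d) (?I n) (?I 1)) (mpoly_ring d)"
        by (intro R.ideal_prod_is_ideal id)
      fix a assume "a \<in> upow E (Suc n)" and a: "Poly_Mapping.keys a \<subseteq> {..<d}"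
      then obtain F b where Fb: "a = F + b" "F \<in> E" "b \<in> upow E n"
        unfolding upow_Suc by blast
      have "F \<in> upow E 1" using Fb upowI[of "[F]" E 1 F 0] by simp
      then have "xpow b \<in> ?I n" "xpow F \<in> ?I 1"
        using a Fb by (simp_all add: xpow_in_monomial_ideal_iff keys_add_nat)
      then show "xpow a \<in> ideal_prod (mpoly_ring d) (?I n) (?I 1)"
        using ideal_prod.prod[of "xpow b" "?I n" "xpow F" "?I 1" "mpoly_ring d"]
        by (simp only: Fb xpow_add mpoly_ring_simps mult.commute)
    qed
  qed
  finally show ?case .
qed

lemma genideal_xpow:
  assumes "\<And>F. F \<in> E \<Longrightarrow> Poly_Mapping.keys F \<subseteq> {..<d}"
  shows "Idl\<^bsub>mpoly_ring d\<^esub> (xpow ` E) = (monomial_ideal d (upow E 1) :: 'k::field mpoly set)"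
proof
  interpret R: domain "mpoly_ring d :: 'k mpoly ring" by (rule domain_mpoly_ring)
  have carr: "xpow ` E \<subseteq> carrier (mpoly_ring d :: 'k mpoly ring)"
    using assms by (auto simp: xpow_in_carrier_iff)
  have E: "F \<in> upow E 1" if "F \<in> E" for F using that upowI[of "[F]" E 1 F 0] by simp
  show "Idl\<^bsub>mpoly_ring d\<^esub> (xpow ` E) \<subseteq> (monomial_ideal d (upow E 1) :: 'k mpoly set)"
    by (rule R.genideal_minimal) (use assms E in \<open>auto intro!: ideal_monomial_ideal upow_up simp: xpow_in_monomial_ideal_iff simp del: One_nat_def\<close>)
  have id: "ideal (Idl\<^bsub>mpoly_ring d\<^esub> (xpow ` E)) (mpoly_ring d :: 'k mpoly ring)"
    by (rule R.genideal_ideal[OF carr])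
  show "(monomial_ideal d (upow E 1) :: 'k mpoly set) \<subseteq> Idl\<^bsub>mpoly_ring d\<^esub> (xpow ` E)"
  proof (rule monomial_ideal_subset[OF id])
    fix a assume "a \<in> upow E 1" and a: "Poly_Mapping.keys a \<subseteq> {..<d}"
    then obtain F b where Fb: "a = F + b" "F \<in> E" unfolding upow_1 by blast
    have "xpow F \<in> Idl\<^bsub>mpoly_ring d\<^esub> (xpow ` E :: 'k mpoly set)"
      using R.genideal_self[OF carr] Fb by auto
    then show "xpow a \<in> Idl\<^bsub>mpoly_ring d\<^esub> (xpow ` E :: 'k mpoly set)"
      unfolding Fb(1) xpow_add mult.commute[of "xpow F"] using a
      by (intro ideal_mpoly_ringD(4)[OF id]) (auto simp: xpow_in_carrier_iff Fb keys_add_nat)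
  qed
qed

text \<open>Square-free exponents are determined by their supports, so there are finitely many.
  Discarding those that are proper multiples of others keeps the ideal, by descent on the degree,
  and leaves an antichain under divisibility.\<close>

lemma squarefree_monomial_ideal_exponents:
  assumes "squarefree_monomial_ideal d (I :: 'k::field mpoly set)"
  obtains E where "finite E" "\<And>F. F \<in> E \<Longrightarrow> Poly_Mapping.keys F \<subseteq> {..<d}"
    "\<And>F i. F \<in> E \<Longrightarrow> Poly_Mapping.lookup F i \<le> 1"
    "\<And>F G c. F \<in> E \<Longrightarrow> G \<in> E \<Longrightarrow> F = G + c \<Longrightarrow> c = 0"
    "I = monomial_ideal d (upow E 1)"
proof -
  obtain S where S: "S \<subseteq> squarefree_monomials d" "I = Idl\<^bsub>mpoly_ring d\<^esub> S"
    using assms by (auto simp: squarefree_monomial_ideal_def)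
  define E0 where "E0 = {a. xpow a \<in> S}"
  have inj: "a = b" if "xpow a = (xpow b :: 'k mpoly)" for a b
    using arg_cong[OF that, of Poly_Mapping.keys] by simp
  have E0: "Poly_Mapping.keys F \<subseteq> {..<d}" "Poly_Mapping.lookup F i \<le> 1" if "F \<in> E0" for F i
  proof -
    have "xpow F \<in> (squarefree_monomials d :: 'k mpoly set)" using that S(1) by (auto simp: E0_def)
    then obtain a where "xpow F = (xpow a :: 'k mpoly)" "Poly_Mapping.keys a \<subseteq> {..<d}"
        "\<forall>i. Poly_Mapping.lookup a i \<le> 1" by (auto simp: squarefree_monomials_def)
    with inj show "Poly_Mapping.keys F \<subseteq> {..<d}" "Poly_Mapping.lookup F i \<le> 1" by blast+
  qed
  have "x \<in> range xpow" if "x \<in> S" for x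
    using that S(1) by (auto simp: squarefree_monomials_def)
  then have S_eq: "S = xpow ` E0" by (auto simp: E0_def)
  have "inj_on Poly_Mapping.keys E0"
  proof (rule inj_onI, rule poly_mapping_eqI)
    fix F G i assume *: "F \<in> E0" "G \<in> E0" "Poly_Mapping.keys F = Poly_Mapping.keys G"
    have "Poly_Mapping.lookup F i = 0 \<longleftrightarrow> Poly_Mapping.lookup G i = 0"
      using *(3) by (metis in_keys_iff)
    then show "Poly_Mapping.lookup F i = Poly_Mapping.lookup G i"
      using E0(2)[OF *(1), of i] E0(2)[OF *(2), of i] by linarith
  qed
  moreover have "finite (Poly_Mapping.keys ` E0)"
    by (rule finite_subset[of _ "Pow {..<d}"]) (use E0(1) in auto)
  ultimately have fin: "finite E0" using finite_imageD by blast
  define E where "E = {F \<in> E0. \<forall>G\<in>E0. \<forall>c. F = G + c \<longrightarrow> c = 0}"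
  have min: "\<exists>G\<in>E. \<exists>c. F = G + c" if "F \<in> E0" for F
    using that
  proof (induction "weight {..<d} F" arbitrary: F rule: less_induct)
    case less
    show ?case
    proof (cases "F \<in> E")
      case True
      then show ?thesis by (intro bexI[of _ F] exI[of _ 0]) auto
    next
      case False
      then obtain G c where G: "G \<in> E0" "F = G + c" "c \<noteq> 0" using less.prems by (auto simp: E_def)
      have "Poly_Mapping.keys c \<subseteq> {..<d}" using E0(1)[OF less.prems] by (simp add: G keys_add_nat)
      then have "weight {..<d} G < weight {..<d} F"
        using G weight_pos_iff[of "{..<d}" c] by (simp add: Int_absorb1)
      with less.hyps G show ?thesis by (metis add.assoc)
    qed
  qed
  have "upow E 1 = upow E0 1"
  proof safe
    show "a \<in> upow E0 1" if "a \<in> upow E 1" for a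
      using that unfolding upow_1 E_def by blast
    show "a \<in> upow E 1" if "a \<in> upow E0 1" for a
    proof -
      obtain F b where "F \<in> E0" "a = F + b" using \<open>a \<in> upow E0 1\<close> unfolding upow_1 by blast
      moreover then obtain G c where "G \<in> E" "F = G + c" using min by blast
      ultimately show ?thesis unfolding upow_1 by (metis add.assoc)
    qed
  qed
  moreover have "Idl\<^bsub>mpoly_ring d\<^esub> (xpow ` E0) = (monomial_ideal d (upow E0 1) :: 'k mpoly set)"
    by (rule genideal_xpow) (rule E0(1))
  ultimately have "I = monomial_ideal d (upow E 1)" using S(2) S_eq by simp
  then show ?thesis using that[of E] E0 fin by (auto simp: E_def)
qed

section \<open>The number of generators\<close>

lemma lookup_scale: "Poly_Mapping.lookup (Poly_Mapping.single 0 c * f) a = c * Poly_Mapping.lookup f a"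
  for f :: "'k::field mpoly"
  by (simp flip: mult_map_scale_conv_mult add: map.rep_eq when_def)

text \<open>
  Taking the coefficients at the minimal exponents turns ring multiples into scalar
  multiples, so any generating set spans a space of dimension \<open>card E\<close>.
\<close>
lemma lookup_mult_minimal:
  fixes f g :: "'k::field mpoly"
  assumes g: "g \<in> monomial_ideal d (upow E 1)" and F: "F \<in> E"
    and min: "\<And>F G c. F \<in> E \<Longrightarrow> G \<in> E \<Longrightarrow> F = G + c \<Longrightarrow> c = 0"
  shows "Poly_Mapping.lookup (f * g) F = Poly_Mapping.lookup f 0 * Poly_Mapping.lookup g F"
proof -
  \<comment> \<open>Without its constant term, the factor only moves generators to strictly larger
    exponents, and a minimal \<open>F\<close> is not among these.\<close>
  define f' where "f' = f - Poly_Mapping.single 0 (Poly_Mapping.lookup f 0)"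
  have "0 \<notin> Poly_Mapping.keys f'" by (simp add: f'_def in_keys_iff lookup_minus)
  have "F \<notin> Poly_Mapping.keys (f' * g)"
  proof
    assume "F \<in> Poly_Mapping.keys (f' * g)"
    then obtain b c where bc: "b \<in> Poly_Mapping.keys f'" "c \<in> Poly_Mapping.keys g" "F = b + c"
      using keys_mult[of f' g] by blast
    then have "c \<in> upow E 1" using g by (auto simp: monomial_ideal_def)
    then obtain G e where "G \<in> E" "c = G + e" unfolding upow_1 by blast
    then have "e + b = 0" using min[OF F, of G "e + b"] bc(3) by (simp add: ac_simps)
    then have "b = 0" using keys_add_nat[of e b] by (simp flip: keys_eq_empty)
    with bc(1) \<open>0 \<notin> Poly_Mapping.keys f'\<close> show False by simp
  qed
  moreover have "f * g = Poly_Mapping.single 0 (Poly_Mapping.lookup f 0) * g + f' * g"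
    by (simp add: f'_def algebra_simps)
  ultimately show ?thesis by (simp add: lookup_add lookup_scale in_keys_iff)
qed

lemma card_le_min_num_gens:
  fixes E :: "(nat \<Rightarrow>\<^sub>0 nat) set" and d :: nat
  defines "M \<equiv> monomial_ideal d (upow E 1) :: 'k::field mpoly set"
  assumes fin: "finite E" and E: "\<And>F. F \<in> E \<Longrightarrow> Poly_Mapping.keys F \<subseteq> {..<d}"
    and min: "\<And>F G c. F \<in> E \<Longrightarrow> G \<in> E \<Longrightarrow> F = G + c \<Longrightarrow> c = 0"
  shows "card E \<le> min_num_gens (mpoly_ring d) M"
proof -
  interpret R: domain "mpoly_ring d :: 'k mpoly ring" by (rule domain_mpoly_ring)
  \<comment> \<open>The monomials in \<open>E\<close> form one finite generating set, so the least
    size is attained by some \<open>G\<close>, whose elements need not be monomials.\<close>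
  have "\<exists>m. \<exists>G. finite G \<and> card G = m \<and> G \<subseteq> carrier (mpoly_ring d) \<and> Idl\<^bsub>mpoly_ring d\<^esub> G = M"
  proof (intro exI conjI)
    show "finite (xpow ` E)" using fin by simp
    show "Idl\<^bsub>mpoly_ring d\<^esub> (xpow ` E) = M" unfolding M_def by (rule genideal_xpow) (rule E)
    show "xpow ` E \<subseteq> carrier (mpoly_ring d)" using E by (auto simp: xpow_in_carrier_iff)
  qed (rule refl)
  from LeastI_ex[OF this] obtain G where G: "finite G" "card G = min_num_gens (mpoly_ring d) M"
      "G \<subseteq> carrier (mpoly_ring d)" "Idl\<^bsub>mpoly_ring d\<^esub> G = M"
    unfolding min_num_gens_def by blast
  have idM: "ideal M (mpoly_ring d)" unfolding M_def by (intro ideal_monomial_ideal upow_up)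
  \<comment> \<open>Scalars act as constant polynomials; \<open>\<pi>\<close> then projects onto the
    span of the minimal monomials.\<close>
  interpret vs: vector_space "\<lambda>c f. Poly_Mapping.single 0 c * f :: 'k mpoly"
    by unfold_locales (simp_all add: algebra_simps single_add mult_single flip: mult.assoc)
  define \<pi> where "\<pi> g = (\<Sum>F\<in>E. Poly_Mapping.single F (Poly_Mapping.lookup g F))" for g :: "'k mpoly"
  have lookup_pi: "Poly_Mapping.lookup (\<pi> g) F = (if F \<in> E then Poly_Mapping.lookup g F else 0)" for g F
    unfolding \<pi>_def by (rule lookup_sum_single[OF fin])
  \<comment> \<open>\<open>J\<close> is an ideal because a ring multiple acts on the projection
    through its constant term only. It contains \<open>G\<close>, hence all of \<open>M\<close>, and
    so the independent monomials of \<open>E\<close> lie in a span of at most \<open>card G\<close>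
    vectors.\<close>
  define J where "J = {g \<in> M. \<pi> g \<in> vs.span (\<pi> ` G)}"
  have "ideal J (mpoly_ring d)"
  proof (rule ideal_mpoly_ringI)
    show "J \<subseteq> carrier (mpoly_ring d)" using ideal_mpoly_ringD(1)[OF idM] by (auto simp: J_def)
    have "\<pi> 0 = 0" by (simp add: \<pi>_def)
    then show "0 \<in> J" using ideal_mpoly_ringD(2)[OF idM] vs.span_zero by (simp add: J_def)
  next
    fix x y assume "x \<in> J" "y \<in> J"
    moreover have "\<pi> (x + y) = \<pi> x + \<pi> y" by (rule poly_mapping_eqI) (simp add: lookup_pi lookup_add)
    ultimately show "x + y \<in> J" using ideal_mpoly_ringD(3)[OF idM] vs.span_add by (simp add: J_def)
  next
    fix x y :: "'k mpoly" assume *: "x \<in> carrier (mpoly_ring d)" "y \<in> J"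
    have "\<pi> (x * y) = Poly_Mapping.single 0 (Poly_Mapping.lookup x 0) * \<pi> y"
    proof (rule poly_mapping_eqI)
      show "Poly_Mapping.lookup (\<pi> (x * y)) F =
          Poly_Mapping.lookup (Poly_Mapping.single 0 (Poly_Mapping.lookup x 0) * \<pi> y) F" for F
        using * lookup_mult_minimal[of y d E F x, OF _ _ min] by (simp add: lookup_pi lookup_scale J_def M_def)
    qed
    then show "x * y \<in> J"
      using * ideal_mpoly_ringD(4)[OF idM] vs.span_scale by (simp add: J_def)
  qed
  moreover have "G \<subseteq> J" using R.genideal_self[OF G(3)] G(4) by (auto simp: J_def intro: vs.span_base)
  ultimately have "M \<subseteq> J" using R.genideal_minimal G(4) by metis
  have "xpow ` E \<subseteq> vs.span (\<pi> ` G)"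
  proof safe
    fix F assume F: "F \<in> E"
    then have "F \<in> upow E 1" using upowI[of "[F]" E 1 F 0] by simp
    then have "xpow F \<in> M" using E[OF F] by (simp add: M_def xpow_in_monomial_ideal_iff)
    moreover have "\<pi> (xpow F) = xpow F"
      by (rule poly_mapping_eqI) (use F in \<open>auto simp: lookup_pi lookup_single when_def\<close>)
    ultimately show "xpow F \<in> vs.span (\<pi> ` G)" using \<open>M \<subseteq> J\<close> by (auto simp: J_def)
  qed
  have inj: "inj_on (xpow :: _ \<Rightarrow> 'k mpoly) E"
  proof (rule inj_onI)
    fix F G assume "xpow F = (xpow G :: 'k mpoly)"
    from arg_cong[OF this, of Poly_Mapping.keys] show "F = G" by simp
  qed
  have "vs.independent (xpow ` E)"
  proof (rule vs.independent_if_scalars_zero)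
    fix u :: "'k mpoly \<Rightarrow> 'k" and v :: "'k mpoly"
    assume sum: "(\<Sum>x\<in>xpow ` E. Poly_Mapping.single 0 (u x) * x) = 0" and "v \<in> xpow ` E"
    then obtain F where F: "F \<in> E" "v = xpow F" by auto
    have "(\<Sum>x\<in>xpow ` E. Poly_Mapping.single 0 (u x) * x) = (\<Sum>F\<in>E. Poly_Mapping.single F (u (xpow F)))"
      by (simp add: sum.reindex[OF inj] mult_single)
    then have "Poly_Mapping.lookup (\<Sum>F\<in>E. Poly_Mapping.single F (u (xpow F))) F = 0"
      using sum by simp
    then show "u v = 0" using F by (simp add: lookup_sum_single[OF fin])
  qed (use fin in simp)
  then have "card (xpow ` E :: 'k mpoly set) \<le> card (\<pi> ` G)"
    using vs.independent_span_bound \<open>xpow ` E \<subseteq> vs.span (\<pi> ` G)\<close> G(1) by blast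
  also have "\<dots> \<le> card G" by (rule card_image_le[OF G(1)])
  finally show ?thesis using card_image[OF inj] G(2) by simp
qed

section \<open>Minimal primes\<close>

lemma split_keys:
  fixes f :: "'i \<Rightarrow>\<^sub>0 'k::comm_monoid_add"
  obtains g h where "f = g + h" "Poly_Mapping.keys g = Poly_Mapping.keys f \<inter> A"
    "Poly_Mapping.keys h = Poly_Mapping.keys f - A"
proof
  let ?r = "\<lambda>B. \<Sum>a\<in>B. Poly_Mapping.single a (Poly_Mapping.lookup f a)"
  have r: "Poly_Mapping.lookup (?r B) a = (if a \<in> B then Poly_Mapping.lookup f a else 0)"
    if "B \<subseteq> Poly_Mapping.keys f" for B a
    using that finite_subset[OF that] by (intro lookup_sum_single) auto
  show "f = ?r (Poly_Mapping.keys f \<inter> A) + ?r (Poly_Mapping.keys f - A)"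
    by (rule poly_mapping_eqI) (auto simp: lookup_add r in_keys_iff)
  show "Poly_Mapping.keys (?r (Poly_Mapping.keys f \<inter> A)) = Poly_Mapping.keys f \<inter> A"
    "Poly_Mapping.keys (?r (Poly_Mapping.keys f - A)) = Poly_Mapping.keys f - A"
    by (auto simp: r in_keys_iff split: if_splits)
qed

text \<open>The parts of lowest weight have a nonzero product, as polynomials form a domain. A term
  of this product has weight \<open>p + q\<close>, while the other three partial products have only
  larger weights, so it cannot cancel.\<close>

lemma keys_mult_weight:
  fixes f g :: "'k::field mpoly"
  assumes "a \<in> Poly_Mapping.keys f" "b \<in> Poly_Mapping.keys g"
  shows "\<exists>c\<in>Poly_Mapping.keys (f * g). weight C c \<le> weight C a + weight C b"
proof -
  have split: "\<exists>p f1 f2. f = f1 + f2 \<and> f1 \<noteq> 0 \<and> p \<le> weight C a \<and>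
      (\<forall>e\<in>Poly_Mapping.keys f1. weight C e = p) \<and> (\<forall>e\<in>Poly_Mapping.keys f2. p < weight C e)"
    if a: "a \<in> Poly_Mapping.keys f" for f :: "'k mpoly" and a
  proof -
    define p where "p = Min (weight C ` Poly_Mapping.keys f)"
    have p: "p \<le> weight C e" if "e \<in> Poly_Mapping.keys f" for e
      using that by (simp add: p_def)
    have "p \<in> weight C ` Poly_Mapping.keys f" unfolding p_def using a by (intro Min_in) auto
    then obtain e where e: "e \<in> Poly_Mapping.keys f" "weight C e = p" by auto
    obtain f1 f2 where f: "f = f1 + f2" "Poly_Mapping.keys f1 = Poly_Mapping.keys f \<inter> {e. weight C e = p}"
      "Poly_Mapping.keys f2 = Poly_Mapping.keys f - {e. weight C e = p}"
      by (rule split_keys)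
    have "f1 \<noteq> 0" using f(2) e by auto
    then show ?thesis using f p a by (intro exI[of _ p] exI[of _ f1] exI[of _ f2]) (auto simp: order.strict_iff_order)
  qed
  obtain p f1 f2 where f: "f = f1 + f2" "f1 \<noteq> 0" "p \<le> weight C a"
    "\<And>e. e \<in> Poly_Mapping.keys f1 \<Longrightarrow> weight C e = p" "\<And>e. e \<in> Poly_Mapping.keys f2 \<Longrightarrow> p < weight C e"
    using split[OF assms(1)] by blast
  obtain q g1 g2 where g: "g = g1 + g2" "g1 \<noteq> 0" "q \<le> weight C b"
    "\<And>e. e \<in> Poly_Mapping.keys g1 \<Longrightarrow> weight C e = q" "\<And>e. e \<in> Poly_Mapping.keys g2 \<Longrightarrow> q < weight C e"
    using split[OF assms(2)] by blast
  have "f1 * g1 \<noteq> 0" using f(2) g(2) by simp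
  then obtain c where c: "c \<in> Poly_Mapping.keys (f1 * g1)" by (metis ex_in_conv keys_eq_empty)
  then have w: "weight C c = p + q" using keys_mult[of f1 g1] f(4) g(4) by fastforce
  have "c \<notin> Poly_Mapping.keys (f1 * g2)" using keys_mult[of f1 g2] f(4) g(5) w by fastforce
  moreover have "c \<notin> Poly_Mapping.keys (f2 * g1)" using keys_mult[of f2 g1] f(5) g(4) w by fastforce
  moreover have "c \<notin> Poly_Mapping.keys (f2 * g2)" using keys_mult[of f2 g2] f(5) g(5) w by fastforce
  moreover have "f * g = f1 * g1 + f1 * g2 + f2 * g1 + f2 * g2"
    unfolding f(1) g(1) by (simp add: algebra_simps)
  ultimately have "c \<in> Poly_Mapping.keys (f * g)" using c by (simp add: in_keys_iff lookup_add)
  then show ?thesis using w f(3) g(3) by (intro bexI[of _ c]) auto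
qed

text \<open>For finite \<open>C\<close> a positive weight means that some variable of
  \<open>C\<close> divides the monomial: the ideal is generated by the variables in \<open>C\<close>
  below \<open>d\<close>. For infinite \<open>C\<close> the sum defaults to 0 and the ideal is zero,
  which is still prime.\<close>

definition var_ideal :: "nat \<Rightarrow> nat set \<Rightarrow> 'k::field mpoly set" where
  "var_ideal d C = monomial_ideal d {a. 0 < weight C a}"

lemma not_in_var_ideal:
  assumes "f \<in> carrier (mpoly_ring d)" "f \<notin> var_ideal d C"
  obtains a where "a \<in> Poly_Mapping.keys f" "weight C a = 0"
  using assms by (auto simp: var_ideal_def monomial_ideal_def)

lemma primeideal_var_ideal: "primeideal (var_ideal d C :: 'k::field mpoly set) (mpoly_ring d)"
proof (rule primeidealI)
  interpret R: domain "mpoly_ring d :: 'k mpoly ring" by (rule domain_mpoly_ring)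
  show "cring (mpoly_ring d :: 'k mpoly ring)" by (rule R.is_cring)
  show "ideal (var_ideal d C :: 'k mpoly set) (mpoly_ring d)"
    unfolding var_ideal_def by (rule ideal_monomial_ideal) simp
  have "(1 :: 'k mpoly) \<notin> var_ideal d C" "(1 :: 'k mpoly) \<in> carrier (mpoly_ring d)"
    by (simp_all add: var_ideal_def monomial_ideal_def carrier_mpoly_ring)
  then show "carrier (mpoly_ring d) \<noteq> (var_ideal d C :: 'k mpoly set)" by blast
  fix f g :: "'k mpoly"
  assume fg: "f \<in> carrier (mpoly_ring d)" "g \<in> carrier (mpoly_ring d)"
    and "f \<otimes>\<^bsub>mpoly_ring d\<^esub> g \<in> var_ideal d C"
  then have prod: "f * g \<in> var_ideal d C" by simp
  show "f \<in> var_ideal d C \<or> g \<in> var_ideal d C"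
  proof (rule ccontr)
    assume "\<not> ?thesis"
    then obtain a b where "a \<in> Poly_Mapping.keys f" "weight C a = 0" "b \<in> Poly_Mapping.keys g" "weight C b = 0"
      using fg not_in_var_ideal by metis
    then obtain c where "c \<in> Poly_Mapping.keys (f * g)" "weight C c = 0"
      using keys_mult_weight[of a f b g C] by auto
    with prod show False by (auto simp: var_ideal_def monomial_ideal_def)
  qed
qed

abbreviation unit_exp :: "nat \<Rightarrow> nat \<Rightarrow>\<^sub>0 nat" where
  "unit_exp i \<equiv> Poly_Mapping.single i 1"

lemma weight_unit_exp: "finite C \<Longrightarrow> weight C (unit_exp i) = (if i \<in> C then 1 else 0)"
  by (simp add: weight_def lookup_single when_def)

lemma xpow_unit_in_var_ideal_iff:
  "C \<subseteq> {..<d} \<Longrightarrow> xpow (unit_exp i) \<in> var_ideal d C \<longleftrightarrow> i \<in> C"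
  using weight_unit_exp[of C i] finite_subset[of C "{..<d}"]
  by (auto simp: var_ideal_def xpow_in_monomial_ideal_iff)

definition vars_of :: "nat \<Rightarrow> 'k::field mpoly set \<Rightarrow> nat set" where
  "vars_of d P = {i. i < d \<and> xpow (unit_exp i) \<in> P}"

lemma primeideal_xpow:
  fixes P :: "'k::field mpoly set"
  assumes "primeideal P (mpoly_ring d)" "Poly_Mapping.keys a \<subseteq> {..<d}" "xpow a \<in> P"
  shows "vars_of d P \<inter> Poly_Mapping.keys a \<noteq> {}"
proof -
  interpret P: primeideal P "mpoly_ring d" by fact
  \<comment> \<open>The support bound is carried through the induction, because primality may be
    applied only to factors in the carrier.\<close>
  have "Poly_Mapping.keys a \<subseteq> {..<d} \<and> (xpow a \<in> P \<longrightarrow> vars_of d P \<inter> Poly_Mapping.keys a \<noteq> {})"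
    using assms(2)
  proof (induction a rule: exponent_induct)
    case zero
    have "(1 :: 'k mpoly) \<notin> P" using P.one_imp_carrier P.I_notcarr by auto
    then show ?case by simp
  next
    case (add b i)
    have "xpow (unit_exp i) \<in> P \<or> xpow b \<in> P" if "xpow (unit_exp i + b) \<in> P"
    proof (rule P.I_prime)
      show "xpow (unit_exp i) \<otimes>\<^bsub>mpoly_ring d\<^esub> xpow b \<in> P"
        using that by (simp only: xpow_add mpoly_ring_simps)
    qed (use add in \<open>auto simp: xpow_in_carrier_iff\<close>)
    then show ?case using add by (auto simp: keys_add_nat vars_of_def)
  qed
  then show ?thesis using assms(3) by blast
qed

lemma var_ideal_vars_of_subset:
  fixes P :: "'k::field mpoly set"
  assumes "ideal P (mpoly_ring d)"
  shows "var_ideal d (vars_of d P) \<subseteq> P"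
  unfolding var_ideal_def
proof (rule monomial_ideal_subset[OF assms])
  fix a assume a: "a \<in> {a. 0 < weight (vars_of d P) a}" and keys: "Poly_Mapping.keys a \<subseteq> {..<d}"
  have "finite (vars_of d P)" by (simp add: vars_of_def)
  then obtain i where i: "i \<in> vars_of d P" "i \<in> Poly_Mapping.keys a"
    using a by (auto simp: weight_pos_iff)
  then have "Poly_Mapping.lookup a i \<noteq> 0" by (simp add: in_keys_iff)
  then obtain b where b: "a = unit_exp i + b" by (rule split_unit)
  show "xpow a \<in> P" unfolding b xpow_add mult.commute[of "xpow (unit_exp i)"]
    using i keys b by (intro ideal_mpoly_ringD(4)[OF assms]) (auto simp: vars_of_def xpow_in_carrier_iff keys_add_nat)
qed

definition minimal_cover :: "nat \<Rightarrow> (nat \<Rightarrow>\<^sub>0 nat) set \<Rightarrow> nat set \<Rightarrow> bool" where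
  "minimal_cover d E C \<longleftrightarrow> C \<subseteq> {..<d} \<and> is_cover E C \<and> (\<forall>C'\<subseteq>C. is_cover E C' \<longrightarrow> C' = C)"

context
  fixes E :: "(nat \<Rightarrow>\<^sub>0 nat) set" and d :: nat and I :: "'k::field mpoly set"
  assumes E: "\<And>F. F \<in> E \<Longrightarrow> Poly_Mapping.keys F \<subseteq> {..<d}"
  defines "I \<equiv> monomial_ideal d (upow E 1)"
begin

lemma is_cover_vars_of:
  assumes "primeideal P (mpoly_ring d)" "I \<subseteq> P"
  shows "is_cover E (vars_of d P)"
  unfolding is_cover_def
proof
  fix F assume F: "F \<in> E"
  then have "F \<in> upow E 1" using upowI[of "[F]" E 1 F 0] by simp
  then have "xpow F \<in> I" using E[OF F] by (simp add: I_def xpow_in_monomial_ideal_iff)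
  then show "vars_of d P \<inter> Poly_Mapping.keys F \<noteq> {}"
    using primeideal_xpow[OF assms(1) E[OF F]] assms(2) by blast
qed

lemma ideal_subset_var_ideal:
  assumes "C \<subseteq> {..<d}" "is_cover E C"
  shows "I \<subseteq> var_ideal d C"
proof -
  have "finite C" using assms(1) finite_subset by blast
  then have "upow E 1 \<subseteq> {a. 0 < weight C a}" using upow_weight[OF _ assms(2), of _ 1] by force
  then show ?thesis by (auto simp: I_def var_ideal_def monomial_ideal_def)
qed

text \<open>The variables in a prime above \<open>I\<close> form a cover, and the prime contains the
  ideal of that cover. Minimal primes are therefore variable ideals, and inclusions among these
  correspond to inclusions of covers.\<close>

lemma minimal_primes_eq: "minimal_primes (mpoly_ring d) I = var_ideal d ` {C. minimal_cover d E C}"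
proof safe
  fix P assume "P \<in> minimal_primes (mpoly_ring d) I"
  then have P: "primeideal P (mpoly_ring d)" "I \<subseteq> P"
    and min: "\<And>Q. primeideal Q (mpoly_ring d) \<Longrightarrow> I \<subseteq> Q \<Longrightarrow> Q \<subseteq> P \<Longrightarrow> Q = P"
    by (auto simp: minimal_primes_def)
  let ?C = "vars_of d P"
  have C: "?C \<subseteq> {..<d}" by (auto simp: vars_of_def)
  have cov: "is_cover E ?C" by (rule is_cover_vars_of[OF P])
  have sub: "var_ideal d C \<subseteq> P" if "C \<subseteq> ?C" for C
  proof -
    have "weight C a \<le> weight ?C a" for a
      unfolding weight_def using that by (intro sum_mono2) (auto simp: vars_of_def)
    then have "{a. 0 < weight C a} \<subseteq> {a. 0 < weight ?C a}" using order.strict_trans2 by blast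
    then have "var_ideal d C \<subseteq> (var_ideal d ?C :: 'k mpoly set)"
      unfolding var_ideal_def monomial_ideal_def by blast
    also have "\<dots> \<subseteq> P" by (rule var_ideal_vars_of_subset[OF primeideal.axioms(1)[OF P(1)]])
    finally show ?thesis .
  qed
  \<comment> \<open>For every cover inside \<open>vars_of d P\<close> the variable ideal is a prime
    between \<open>I\<close> and \<open>P\<close>, so minimality of \<open>P\<close> forces
    equality.\<close>
  have eq: "var_ideal d C = P" if "C \<subseteq> ?C" "is_cover E C" for C
    using that C by (intro min primeideal_var_ideal ideal_subset_var_ideal sub) auto
  have "minimal_cover d E ?C"
    unfolding minimal_cover_def
  proof (intro conjI allI impI C cov)
    fix C' assume C': "C' \<subseteq> ?C" "is_cover E C'"
    have "i \<in> C'" if "i \<in> ?C" for i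
      using that C' C xpow_unit_in_var_ideal_iff[of C' d i, where 'a = 'k] eq[OF C']
      by (auto simp: vars_of_def)
    with C' show "C' = ?C" by blast
  qed
  then show "P \<in> var_ideal d ` {C. minimal_cover d E C}" using eq[OF order_refl cov] by auto
next
  fix C assume "minimal_cover d E C"
  then have C: "C \<subseteq> {..<d}" "is_cover E C" "\<And>C'. C' \<subseteq> C \<Longrightarrow> is_cover E C' \<Longrightarrow> C' = C"
    by (auto simp: minimal_cover_def)
  show "var_ideal d C \<in> minimal_primes (mpoly_ring d) I"
    unfolding minimal_primes_def
  proof (safe intro!: primeideal_var_ideal)
    show "f \<in> var_ideal d C" if "f \<in> I" for f using ideal_subset_var_ideal[OF C(1,2)] that by blast
    fix Q assume Q: "primeideal Q (mpoly_ring d)" "I \<subseteq> Q" "Q \<subseteq> var_ideal d C"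
    have "vars_of d Q \<subseteq> C"
      using Q(3) xpow_unit_in_var_ideal_iff[OF C(1), where 'a = 'k] by (auto simp: vars_of_def)
    then have "vars_of d Q = C" using is_cover_vars_of[OF Q(1,2)] C(3) by blast
    then show "f \<in> Q" if "f \<in> var_ideal d C" for f
      using var_ideal_vars_of_subset[OF primeideal.axioms(1)[OF Q(1)]] that by blast
  qed
qed

end

section \<open>Symbolic powers\<close>

context
  fixes d :: nat and P J :: "'k::field mpoly set"
  assumes P: "primeideal P (mpoly_ring d)" and J: "ideal J (mpoly_ring d)"
begin

abbreviation "denoms \<equiv> carrier (mpoly_ring d) - P"

lemma one_in_denoms: "1 \<in> denoms"
proof -
  interpret P: primeideal P "mpoly_ring d" by fact
  show ?thesis using P.one_imp_carrier P.I_notcarr P.one_closed by auto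
qed

lemma mult_in_denoms: "s \<in> denoms \<Longrightarrow> t \<in> denoms \<Longrightarrow> s * t \<in> denoms"
proof -
  interpret P: primeideal P "mpoly_ring d" by fact
  show "s \<in> denoms \<Longrightarrow> t \<in> denoms \<Longrightarrow> s * t \<in> denoms"
    using P.I_prime[of s t] carrier_mult_closed[of s d t] by auto
qed

lemma denoms_nonzero: "s \<in> denoms \<Longrightarrow> s \<noteq> 0"
  using ideal_mpoly_ringD(2)[OF primeideal.axioms(1)[OF P]] by auto

text \<open>Sums are handled by multiplying the two denominators. That this is an ideal later
  permits testing it on monomials, each with its own denominator.\<close>

lemma ideal_saturation: "ideal {f \<in> carrier (mpoly_ring d). \<exists>s\<in>denoms. f * s \<in> J} (mpoly_ring d)"
proof (rule ideal_mpoly_ringI)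
  show "0 \<in> {f \<in> carrier (mpoly_ring d). \<exists>s\<in>denoms. f * s \<in> J}"
  proof -
    have "0 \<in> carrier (mpoly_ring d)" "0 * 1 \<in> J"
      using ideal_mpoly_ringD(2)[OF J] by (simp_all add: carrier_mpoly_ring)
    with one_in_denoms show ?thesis by blast
  qed
next
  fix x y assume "x \<in> {f \<in> carrier (mpoly_ring d). \<exists>s\<in>denoms. f * s \<in> J}"
    "y \<in> {f \<in> carrier (mpoly_ring d). \<exists>s\<in>denoms. f * s \<in> J}"
  then obtain s t where *: "x \<in> carrier (mpoly_ring d)" "y \<in> carrier (mpoly_ring d)"
    "s \<in> denoms" "t \<in> denoms" "x * s \<in> J" "y * t \<in> J" by blast
  have "(x + y) * (s * t) = t * (x * s) + s * (y * t)" by (simp add: algebra_simps)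
  also have "\<dots> \<in> J"
    using ideal_mpoly_ringD(4)[OF J, of t "x * s"] ideal_mpoly_ringD(4)[OF J, of s "y * t"] *
    by (intro ideal_mpoly_ringD(3)[OF J]) auto
  finally show "x + y \<in> {f \<in> carrier (mpoly_ring d). \<exists>s\<in>denoms. f * s \<in> J}"
    using * mult_in_denoms[OF *(3,4)] carrier_add_closed by blast
next
  fix x y :: "'k mpoly" assume *: "x \<in> carrier (mpoly_ring d)" "y \<in> {f \<in> carrier (mpoly_ring d). \<exists>s\<in>denoms. f * s \<in> J}"
  then obtain s where s: "s \<in> denoms" "y * s \<in> J" by blast
  have "x * (y * s) \<in> J" using ideal_mpoly_ringD(4)[OF J] * s by blast
  then show "x * y \<in> {f \<in> carrier (mpoly_ring d). \<exists>s\<in>denoms. f * s \<in> J}"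
    using * s carrier_mult_closed by (auto simp: mult.assoc)
qed auto

text \<open>Fractions with numerator in \<open>J\<close> already form an ideal of the localization,
  so membership gives \<open>f / 1 = g / s\<close> and cross-multiplication gives
  \<open>f * s = g\<close>. Conversely, \<open>f * s\<close> is multiplied by the unit fraction
  \<open>1 / s\<close>.\<close>

lemma fract_in_localized_ideal_iff:
  assumes f: "f \<in> carrier (mpoly_ring d)"
  shows "Fraction_Field.Fract f 1 \<in> Idl\<^bsub>localization (mpoly_ring d) P\<^esub> ((\<lambda>f. Fraction_Field.Fract f 1) ` J)
    \<longleftrightarrow> (\<exists>s\<in>denoms. f * s \<in> J)"
proof
  interpret L: domain "localization (mpoly_ring d) P" by (rule domain_localization[OF P])
  have Jc: "J \<subseteq> carrier (mpoly_ring d)" by (rule ideal_mpoly_ringD(1)[OF J])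
  let ?K = "{Fraction_Field.Fract g s | g s. g \<in> J \<and> s \<in> denoms}"
  have carrL: "carrier (localization (mpoly_ring d) P) =
      {Fraction_Field.Fract r s | r s. r \<in> carrier (mpoly_ring d) \<and> s \<in> denoms}"
    by (simp add: localization_def)
  have multL: "x \<otimes>\<^bsub>localization (mpoly_ring d) P\<^esub> y = x * y" for x y
    by (simp add: localization_def)
  show "\<exists>s\<in>denoms. f * s \<in> J"
    if "Fraction_Field.Fract f 1 \<in> Idl\<^bsub>localization (mpoly_ring d) P\<^esub> ((\<lambda>f. Fraction_Field.Fract f 1) ` J)"
  proof -
    have "ideal ?K (localization (mpoly_ring d) P)"
      unfolding localization_def
    proof (rule ideal_of_type_subsetI)
      show "ring (ring_of_type_algebra\<lparr>carrier := {Fraction_Field.Fract r s | r s. r \<in> carrier (mpoly_ring d) \<and> s \<in> denoms}\<rparr>)"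
        using L.ring_axioms by (simp add: localization_def)
      show "?K \<subseteq> {Fraction_Field.Fract r s | r s. r \<in> carrier (mpoly_ring d) \<and> s \<in> denoms}"
        using Jc by blast
      have "(0 :: 'k mpoly fract) = Fraction_Field.Fract 0 1" by (simp add: Zero_fract_def)
      then show "0 \<in> ?K" using one_in_denoms ideal_mpoly_ringD(2)[OF J] by blast
    next
      fix x y assume "x \<in> ?K" "y \<in> ?K"
      then obtain g s h t where *: "x = Fraction_Field.Fract g s" "y = Fraction_Field.Fract h t"
        "g \<in> J" "s \<in> denoms" "h \<in> J" "t \<in> denoms" by blast
      then have "x + y = Fraction_Field.Fract (t * g + s * h) (s * t)"
        using denoms_nonzero by (simp add: mult.commute)
      moreover have "t * g + s * h \<in> J"
        using ideal_mpoly_ringD(4)[OF J, of t g] ideal_mpoly_ringD(4)[OF J, of s h] *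
        by (intro ideal_mpoly_ringD(3)[OF J]) auto
      ultimately show "x + y \<in> ?K" using mult_in_denoms[OF *(4,6)] by blast
    next
      fix x y assume "x \<in> {Fraction_Field.Fract r s | r s. r \<in> carrier (mpoly_ring d) \<and> s \<in> denoms}" "y \<in> ?K"
      then obtain r s h t where *: "x = Fraction_Field.Fract r s" "y = Fraction_Field.Fract h t"
        "r \<in> carrier (mpoly_ring d)" "s \<in> denoms" "h \<in> J" "t \<in> denoms" by blast
      then have "x * y = Fraction_Field.Fract (r * h) (s * t)" by simp
      moreover have "r * h \<in> J" using ideal_mpoly_ringD(4)[OF J] * by blast
      ultimately show "x * y \<in> ?K" using mult_in_denoms[OF *(4,6)] by blast
    qed
    moreover have "(\<lambda>f. Fraction_Field.Fract f 1) ` J \<subseteq> ?K" using one_in_denoms by blast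
    ultimately have "Fraction_Field.Fract f 1 \<in> ?K" using L.genideal_minimal that by blast
    then obtain g s where gs: "Fraction_Field.Fract f 1 = Fraction_Field.Fract g s" "g \<in> J" "s \<in> denoms" by blast
    then have "f * s = g" using denoms_nonzero[OF gs(3)] by (simp add: eq_fract)
    with gs show ?thesis by blast
  qed
  show "Fraction_Field.Fract f 1 \<in> Idl\<^bsub>localization (mpoly_ring d) P\<^esub> ((\<lambda>f. Fraction_Field.Fract f 1) ` J)"
    if loc: "\<exists>s\<in>denoms. f * s \<in> J"
  proof -
    obtain s where s: "s \<in> denoms" "f * s \<in> J" using loc by blast
    have sub: "(\<lambda>f. Fraction_Field.Fract f 1) ` J \<subseteq> carrier (localization (mpoly_ring d) P)"
      unfolding carrL using one_in_denoms Jc by blast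
    have "Fraction_Field.Fract (f * s) 1 \<in> Idl\<^bsub>localization (mpoly_ring d) P\<^esub> ((\<lambda>f. Fraction_Field.Fract f 1) ` J)"
      using L.genideal_self[OF sub] s(2) by blast
    moreover have "Fraction_Field.Fract 1 s \<in> carrier (localization (mpoly_ring d) P)"
      unfolding carrL using s one_in_denoms by blast
    ultimately have "Fraction_Field.Fract 1 s * Fraction_Field.Fract (f * s) 1 \<in>
        Idl\<^bsub>localization (mpoly_ring d) P\<^esub> ((\<lambda>f. Fraction_Field.Fract f 1) ` J)"
      using ideal.I_l_closed[OF L.genideal_ideal[OF sub]] by (metis multL)
    moreover have "Fraction_Field.Fract 1 s * Fraction_Field.Fract (f * s) 1 = Fraction_Field.Fract f 1"
      using denoms_nonzero[OF s(1)] by (simp add: eq_fract)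
    ultimately show ?thesis by simp
  qed
qed

end

section \<open>Covers and symbolic powers\<close>

lemma ex_minimal_cover:
  assumes "C \<subseteq> {..<d}" "is_cover E C"
  shows "\<exists>C'\<subseteq>C. minimal_cover d E C'"
proof -
  have "finite C" using assms(1) finite_subset by blast
  then show ?thesis using assms
  proof (induction C rule: finite_psubset_induct)
    case (psubset C)
    show ?case
    proof (cases "minimal_cover d E C")
      case False
      then obtain C' where "C' \<subset> C" "is_cover E C'"
        using psubset.prems by (auto simp: minimal_cover_def)
      then show ?thesis using psubset.IH[of C'] psubset.prems(1) by blast
    qed blast
  qed
qed

text \<open>Without such an \<open>F\<close>, the variable \<open>i\<close> could be dropped from
  the cover.\<close>

lemma minimal_cover_meets_once:
  assumes "minimal_cover d E C" "i \<in> C"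
  shows "\<exists>F\<in>E. C \<inter> Poly_Mapping.keys F = {i}"
proof -
  have "\<not> is_cover E (C - {i})" using assms by (auto simp: minimal_cover_def)
  then obtain F where "F \<in> E" "(C - {i}) \<inter> Poly_Mapping.keys F = {}" by (auto simp: is_cover_def)
  moreover have "C \<inter> Poly_Mapping.keys F \<noteq> {}" using assms(1) \<open>F \<in> E\<close> by (auto simp: minimal_cover_def is_cover_def)
  ultimately show ?thesis by blast
qed

context
  fixes d :: nat and E :: "(nat \<Rightarrow>\<^sub>0 nat) set"
  assumes E: "\<And>F. F \<in> E \<Longrightarrow> Poly_Mapping.keys F \<subseteq> {..<d}"
    and squarefree: "\<And>F i. F \<in> E \<Longrightarrow> Poly_Mapping.lookup F i \<le> 1"
begin

text \<open>Away from \<open>C\<close> variables are invertible, and there each variable of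
  \<open>C\<close> is a generator up to a unit. Every unit of \<open>a\<close> inside
  \<open>C\<close> is completed to some \<open>F\<close> in \<open>E\<close>, and the completing
  factors are collected in \<open>u\<close>.\<close>

lemma upow_outside_minimal_cover:
  assumes C: "minimal_cover d E C" and "Poly_Mapping.keys a \<subseteq> {..<d}"
  shows "\<exists>u. Poly_Mapping.keys u \<subseteq> {..<d} \<and> weight C u = 0 \<and> a + u \<in> upow E (weight C a)"
  using assms(2)
proof (induction a rule: exponent_induct)
  case zero
  show ?case by (intro exI[of _ 0]) simp
next
  case (add b i)
  then obtain u where u: "Poly_Mapping.keys u \<subseteq> {..<d}" "weight C u = 0" "b + u \<in> upow E (weight C b)"
    by blast
  have fin: "finite C" using C finite_subset by (auto simp: minimal_cover_def)
  show ?case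
  proof (cases "i \<in> C")
    case False
    have "b + u + unit_exp i \<in> upow E (weight C b)" using u(3) by (rule upow_up)
    then have "unit_exp i + b + u \<in> upow E (weight C (unit_exp i + b))"
      using False by (simp only: weight_add weight_unit_exp[OF fin] if_False add_0 ac_simps)
    then show ?thesis using u by blast
  next
    case True
    then obtain F where F: "F \<in> E" "C \<inter> Poly_Mapping.keys F = {i}"
      using minimal_cover_meets_once[OF C] by blast
    then have "i \<in> Poly_Mapping.keys F" by blast
    then have "Poly_Mapping.lookup F i \<noteq> 0" by (simp add: in_keys_iff)
    then obtain G where G: "F = unit_exp i + G" by (rule split_unit)
    \<comment> \<open>Square-freeness is used for \<open>j = i\<close>: after one unit is split off,
      \<open>F\<close> has no further power of that variable.\<close>
    have "Poly_Mapping.lookup G j = 0" if "j \<in> C" for j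
    proof (cases "j = i")
      case True
      then show ?thesis using squarefree[OF F(1), of i] by (simp add: G lookup_add)
    next
      case False
      then have "j \<notin> Poly_Mapping.keys F" using that F(2) by blast
      then show ?thesis by (simp add: G keys_add_nat in_keys_iff)
    qed
    then have wG: "weight C G = 0" by (simp add: weight_def)
    have "F + (b + u) \<in> upow E (Suc (weight C b))" unfolding upow_Suc using F(1) u(3) by blast
    moreover have "F + (b + u) = unit_exp i + b + (u + G)" by (simp add: G ac_simps)
    moreover have "weight C (unit_exp i + b) = Suc (weight C b)"
      using True by (simp only: weight_add weight_unit_exp[OF fin]) simp
    ultimately have "unit_exp i + b + (u + G) \<in> upow E (weight C (unit_exp i + b))" by simp
    moreover have "Poly_Mapping.keys (u + G) \<subseteq> {..<d}"
      using u(1) E[OF F(1)] by (simp add: G keys_add_nat)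
    ultimately show ?thesis using u(2) wG by (intro exI[of _ "u + G"]) simp
  qed
qed

text \<open>The minimal primes give conditions for minimal covers only; these extend to all covers
  because each cover contains a minimal one of no larger weight.\<close>

lemma symbolic_power_monomial_ideal:
  "symbolic_power (mpoly_ring d) (monomial_ideal d (upow E 1) :: 'k::field mpoly set) n =
    monomial_ideal d {a. \<forall>C\<subseteq>{..<d}. is_cover E C \<longrightarrow> n \<le> weight C a}"
proof -
  let ?J = "monomial_ideal d (upow E n) :: 'k mpoly set"
  let ?W = "{a. \<forall>C\<subseteq>{..<d}. is_cover E C \<longrightarrow> n \<le> weight C a}"
  have idJ: "ideal ?J (mpoly_ring d)" by (intro ideal_monomial_ideal upow_up)
  have primes: "minimal_primes (mpoly_ring d) (monomial_ideal d (upow E 1) :: 'k mpoly set) =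
      var_ideal d ` {C. minimal_cover d E C}"
    by (rule minimal_primes_eq) (rule E)
  have sym: "f \<in> symbolic_power (mpoly_ring d) (monomial_ideal d (upow E 1) :: 'k mpoly set) n \<longleftrightarrow>
      f \<in> carrier (mpoly_ring d) \<and>
      (\<forall>C. minimal_cover d E C \<longrightarrow> (\<exists>s\<in>carrier (mpoly_ring d) - var_ideal d C. f * s \<in> ?J))" for f
    unfolding symbolic_power_def primes monomial_ideal_power
    using fract_in_localized_ideal_iff[OF primeideal_var_ideal idJ] by blast
  show ?thesis
  proof (intro subset_antisym subsetI)
    fix f assume "f \<in> symbolic_power (mpoly_ring d) (monomial_ideal d (upow E 1) :: 'k mpoly set) n"
    then have f: "f \<in> carrier (mpoly_ring d)"
      and loc: "\<And>C. minimal_cover d E C \<Longrightarrow> \<exists>s\<in>carrier (mpoly_ring d) - var_ideal d C. f * s \<in> ?J"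
      using sym by blast+
    have "n \<le> weight C a" if a: "a \<in> Poly_Mapping.keys f" and C: "C \<subseteq> {..<d}" "is_cover E C" for a C
    proof -
      obtain C' where C': "C' \<subseteq> C" "minimal_cover d E C'" using ex_minimal_cover[OF C] by blast
      have fin: "finite C" "finite C'" using C'(1) C(1) finite_subset[OF C(1)] finite_subset[OF C'(1)] by auto
      obtain s where s: "s \<in> carrier (mpoly_ring d)" "s \<notin> var_ideal d C'" "f * s \<in> ?J"
        using loc[OF C'(2)] by blast
      \<comment> \<open>Since \<open>s\<close> avoids the prime, it has a term of weight zero;
        multiplying by \<open>s\<close> therefore leaves some term whose weight does not exceed that
        of \<open>a\<close>.\<close>
      obtain b where b: "b \<in> Poly_Mapping.keys s" "weight C' b = 0" using not_in_var_ideal[OF s(1,2)] .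
      obtain c where c: "c \<in> Poly_Mapping.keys (f * s)" "weight C' c \<le> weight C' a"
        using keys_mult_weight[OF a b(1), of C'] b(2) by auto
      then have "c \<in> upow E n" using s(3) by (auto simp: monomial_ideal_def)
      then have "n \<le> weight C' c" using upow_weight[OF fin(2)] C'(2) by (auto simp: minimal_cover_def)
      also note c(2)
      also have "weight C' a \<le> weight C a" unfolding weight_def using C'(1) fin(1) by (intro sum_mono2) auto
      finally show ?thesis .
    qed
    then show "f \<in> monomial_ideal d ?W" using f by (auto simp: monomial_ideal_def)
  next
    fix f :: "'k mpoly" assume f: "f \<in> monomial_ideal d ?W"
    have "\<exists>s\<in>carrier (mpoly_ring d) - var_ideal d C. f * s \<in> ?J" if C: "minimal_cover d E C" for C
    proof -
      have "monomial_ideal d ?W \<subseteq> {f \<in> carrier (mpoly_ring d).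
          \<exists>s\<in>carrier (mpoly_ring d) - var_ideal d C. f * s \<in> ?J}"
      proof (rule monomial_ideal_subset[OF ideal_saturation[OF primeideal_var_ideal idJ]])
        fix a assume a: "a \<in> ?W" "Poly_Mapping.keys a \<subseteq> {..<d}"
        then have n: "n \<le> weight C a" using C by (auto simp: minimal_cover_def)
        obtain u where u: "Poly_Mapping.keys u \<subseteq> {..<d}" "weight C u = 0" "a + u \<in> upow E (weight C a)"
          using upow_outside_minimal_cover[OF C a(2)] by blast
        have "xpow (a + u) \<in> ?J"
          using upow_mono[OF u(3) n] a(2) u(1) by (simp add: xpow_in_monomial_ideal_iff keys_add_nat)
        then have "xpow a * xpow u \<in> ?J" by (simp only: xpow_add)
        moreover have "xpow u \<in> carrier (mpoly_ring d) - (var_ideal d C :: 'k mpoly set)"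
          using u by (simp add: xpow_in_carrier_iff var_ideal_def xpow_in_monomial_ideal_iff)
        ultimately show "xpow a \<in> {f \<in> carrier (mpoly_ring d).
            \<exists>s\<in>carrier (mpoly_ring d) - var_ideal d C. f * s \<in> ?J}"
          using a(2) xpow_in_carrier_iff by blast
      qed
      with f show ?thesis by blast
    qed
    then show "f \<in> symbolic_power (mpoly_ring d) (monomial_ideal d (upow E 1) :: 'k mpoly set) n"
      using f sym by (simp add: monomial_ideal_def)
  qed
qed

end

section \<open>The equivalence for square-free monomial ideals\<close>

theorem theorem4:
  fixes d :: nat and I :: "('k::field) mpoly set"
  assumes "squarefree_monomial_ideal d I"
  shows "(\<forall>n::nat. 0 < n \<and> int n \<le> \<lceil>real (min_num_gens (mpoly_ring d) I) / 2\<rceil> \<longrightarrow>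
            I [^]\<^bsub>ideals_set (mpoly_ring d)\<^esub> n = symbolic_power (mpoly_ring d) I n)
         \<longleftrightarrow>
         (\<forall>n::nat. 0 < n \<longrightarrow>
            I [^]\<^bsub>ideals_set (mpoly_ring d)\<^esub> n = symbolic_power (mpoly_ring d) I n)"
proof
  assume small: "\<forall>n::nat. 0 < n \<and> int n \<le> \<lceil>real (min_num_gens (mpoly_ring d) I) / 2\<rceil> \<longrightarrow>
    I [^]\<^bsub>ideals_set (mpoly_ring d)\<^esub> n = symbolic_power (mpoly_ring d) I n"
  obtain E where E: "finite E" "\<And>F. F \<in> E \<Longrightarrow> Poly_Mapping.keys F \<subseteq> {..<d}"
    "\<And>F i. F \<in> E \<Longrightarrow> Poly_Mapping.lookup F i \<le> 1"
    "\<And>F G c. F \<in> E \<Longrightarrow> G \<in> E \<Longrightarrow> F = G + c \<Longrightarrow> c = 0"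
    and I: "I = monomial_ideal d (upow E 1)"
    using squarefree_monomial_ideal_exponents[OF assms] by blast
  define W where "W n = {a. \<forall>C\<subseteq>{..<d}. is_cover E C \<longrightarrow> n \<le> weight C a}" for n
  have pow: "I [^]\<^bsub>ideals_set (mpoly_ring d)\<^esub> n = monomial_ideal d (upow E n)" for n :: nat
    unfolding I by (rule monomial_ideal_power)
  have sym: "symbolic_power (mpoly_ring d) I n = monomial_ideal d (W n)" for n
    unfolding I W_def by (rule symbolic_power_monomial_ideal) (fact E)+
  have card: "card E \<le> min_num_gens (mpoly_ring d) I"
    unfolding I by (rule card_le_min_num_gens) (fact E)+
  have base: "a \<in> upow E (Suc m)" if m: "2 * m + 1 \<le> card E"
    and a: "\<And>C. C \<subseteq> {..<d} \<Longrightarrow> is_cover E C \<Longrightarrow> Suc m \<le> weight C a" for a m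
  proof -
    \<comment> \<open>The exponent \<open>a\<close> may involve variables beyond \<open>d\<close>.
      Covers see only its part \<open>t\<close> below \<open>d\<close>, which is a monomial of the
      ring; the rest is restored as a cofactor.\<close>
    obtain t r where tr: "a = t + r" "Poly_Mapping.keys t = Poly_Mapping.keys a \<inter> {..<d}"
      "Poly_Mapping.keys r = Poly_Mapping.keys a - {..<d}" by (rule split_keys)
    have "weight C a = weight C t" if "C \<subseteq> {..<d}" for C
    proof -
      have "Poly_Mapping.lookup r i = 0" if "i \<in> C" for i
      proof -
        have "i \<notin> Poly_Mapping.keys r" using that \<open>C \<subseteq> {..<d}\<close> tr(3) by blast
        then show ?thesis by (simp add: in_keys_iff)
      qed
      then have "weight C r = 0" by (simp add: weight_def)
      then show ?thesis by (simp add: tr(1))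
    qed
    then have "t \<in> W (Suc m)" using a by (simp add: W_def)
    then have "xpow t \<in> (monomial_ideal d (W (Suc m)) :: 'k mpoly set)"
      using tr(2) by (simp add: xpow_in_monomial_ideal_iff)
    also have "\<dots> = monomial_ideal d (upow E (Suc m))"
    proof -
      \<comment> \<open>The exponent in use is \<open>m + 1\<close>. Being at most the ceiling means
        that \<open>m\<close> lies strictly below half the number of generators, which
        \<open>2 * m + 1 \<le> card E\<close> ensures.\<close>
      have "int m < \<lceil>real (min_num_gens (mpoly_ring d) I) / 2\<rceil>"
        unfolding less_ceiling_iff using m card by simp
      then show ?thesis using small pow sym by simp
    qed
    finally have "t \<in> upow E (Suc m)" by (simp add: xpow_in_monomial_ideal_iff)
    then show ?thesis unfolding tr(1) by (rule upow_up)
  qed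
  have "a \<in> upow E n \<longleftrightarrow> a \<in> W n" if keys: "Poly_Mapping.keys a \<subseteq> {..<d}" for a n
  proof
    assume a: "a \<in> upow E n"
    have "n \<le> weight C a" if "C \<subseteq> {..<d}" "is_cover E C" for C
      using upow_weight[OF finite_subset[OF that(1) finite_lessThan] that(2) a] .
    then show "a \<in> W n" by (simp add: W_def)
  next
    assume a: "a \<in> W n"
    show "a \<in> upow E n"
    proof (rule upow_eq_cover_weight[of E d, OF E(1) _ _ keys])
      show "n \<le> weight C a" if "C \<subseteq> {..<d}" "is_cover E C" for C
        using a that by (simp add: W_def)
    qed (fact E base)+
  qed
  then have "monomial_ideal d (upow E n) = (monomial_ideal d (W n) :: 'k mpoly set)" for n
    unfolding monomial_ideal_def carrier_mpoly_ring by blast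
  then show "\<forall>n::nat. 0 < n \<longrightarrow> I [^]\<^bsub>ideals_set (mpoly_ring d)\<^esub> n = symbolic_power (mpoly_ring d) I n"
    by (simp add: pow sym)
qed blast

end
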